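(* Let $\theta\in(0,1)$ and let $f=u+\mathbf{i}v\in\mathcal F_\theta(E^\infty)$ with $u,v$ real-valued. Suppose that $u$ is summable. If $f$ is regular, then the spectrum of $\mathcal L_f$ (as an operator on $\mathcal F_\theta^b(E^\infty)$) is contained in a disc centred at the origin of radius strictly smaller than $\exp(P(u))$.
   Context: Let $I\subset\mathbb N$ be an at most countable alphabet, $A\colon I\times I\to\{0,1\}$ an incidence matrix, $E^\infty=\{\omega\in I^{\mathbb N}: A_{\omega_j\omega_{j+1}}=1\ \forall j\ge 1\}$ with the subspace topology of the product of discrete topologies, $E^n$ the set of subwords of length $n$ of elements of $E^\infty$, $E^*=\bigcup_{n\ge0}E^n$ ($E^0$ contains only the empty word). Standing assumption: $A$ is finitely irreducible, i.e. there is a finite set $\Lambda\subset E^*$ such that for all $i,j\in I$ there is $\omega\in\Lambda$ with $i\omega j\in E^*$. $\sigma$ is the left shift on $E^\infty$; $[\omega]$ is the cylinder set of $\omega\in E^n$; $S_nf=\sum_{j=0}^{n-1}f\circ\sigma^j$, $S_0f=0$. The pressure of $u\colon E^\infty\to\mathbb R$ is $P(u)=\lim_{n\to\infty}\frac1n\log\sum_{\omega\in E^n}\exp(\sup_{\tau\in[\omega]}S_nu(\tau))$. $\mathcal C(E^\infty)$, $\mathcal C(E^\infty,\mathbb R)$: continuous complex-/real-valued functions; $\mathcal C_b(E^\infty)$: bounded continuous complex-valued functions with the sup norm $\|\cdot\|_\infty$. For $f\in\mathcal C(E^\infty)$ and $n\ge1$, $\mathrm{var}_n(f)=\sup\{|f(x)-f(y)|: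 x_i=y_i\text{ for }i\le n\}$, $\|f\|_\theta=\sup_{n\ge1}\mathrm{var}_n(f)/\theta^n$, $\mathcal F_\theta(E^\infty)=\{f\in\mathcal C(E^\infty):\|f\|_\theta<\infty\}$ (unbounded functions allowed), $\mathcal F_\theta^b(E^\infty)=\mathcal F_\theta(E^\infty)\cap\mathcal C_b(E^\infty)$ with the Banach norm $\|\cdot\|_\theta+\|\cdot\|_\infty$. A real-valued $u\in\mathcal F_\theta(E^\infty)$ is summable if $\sum_{e\in I}\exp(\sup(u|_{[e]}))<\infty$; then $P(u)\in\mathbb R$. For $f=u+\mathbf{i}v\in\mathcal F_\theta(E^\infty)$ with $u$ summable, the Perron-Frobenius operator is $\mathcal L_f(g)(\omega)=\sum_{y:\sigma y=\omega}e^{f(y)}g(y)$, acting on $\mathcal C_b(E^\infty)$ and preserving $\mathcal F_\theta^b(E^\infty)$. For $0\le a<2\pi$, $f=u+\mathbf{i}v$ is called an $a$-function if $e^{\mathbf{i}a+P(u)}$ is an eigenvalue of $\mathcal L_f$ (on $\mathcal C_b(E^\infty)$); equivalently, if there exists $\zeta\in\mathcal C(E^\infty,\mathbb R)$ such that $v-a+\zeta\circ\sigma-\zeta$ takes values only in $2\pi\mathbb Z$. $f$ is called regular if it is not an $a$-function for any $a\in[0,2\pi)$. *)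

theory Defs
  imports "HOL-Analysis.Analysis"
begin

text \<open>
  The alphabet is a set \<open>I\<close> of natural numbers, the incidence matrix is a predicate \<open>A\<close> on letters
  (\<open>A i j\<close> means that the entry is 1). Sequences are indexed from 0. The type \<open>nat \<Rightarrow> nat\<close> carries
  the library's product topology, with \<open>nat\<close> discrete, so that continuity of a function on
  \<open>E\<^sup>\<infinity>\<close> is \<open>continuous_on (shift_space I A)\<close>.
\<close>

definition shift_space :: "nat set \<Rightarrow> (nat \<Rightarrow> nat \<Rightarrow> bool) \<Rightarrow> (nat \<Rightarrow> nat) set" where
  "shift_space I A = {x. (\<forall>j. x j \<in> I) \<and> (\<forall>j. A (x j) (x (Suc j)))}"

definition words :: "nat set \<Rightarrow> (nat \<Rightarrow> nat \<Rightarrow> bool) \<Rightarrow> nat \<Rightarrow> nat list set" where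
  "words I A n = {map x [k..<k + n] | x k. x \<in> shift_space I A}"

definition all_words :: "nat set \<Rightarrow> (nat \<Rightarrow> nat \<Rightarrow> bool) \<Rightarrow> nat list set" where
  "all_words I A = (\<Union>n. words I A n)"

definition finitely_irreducible :: "nat set \<Rightarrow> (nat \<Rightarrow> nat \<Rightarrow> bool) \<Rightarrow> bool" where
  "finitely_irreducible I A \<longleftrightarrow>
     (\<exists>\<Lambda>. finite \<Lambda> \<and> \<Lambda> \<subseteq> all_words I A \<and>
        (\<forall>i\<in>I. \<forall>j\<in>I. \<exists>\<omega>\<in>\<Lambda>. [i] @ \<omega> @ [j] \<in> all_words I A))"

definition cylinder :: "nat set \<Rightarrow> (nat \<Rightarrow> nat \<Rightarrow> bool) \<Rightarrow> nat list \<Rightarrow> (nat \<Rightarrow> nat) set" where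
  "cylinder I A \<omega> = {x \<in> shift_space I A. \<forall>i<length \<omega>. x i = \<omega> ! i}"

definition left_shift :: "(nat \<Rightarrow> nat) \<Rightarrow> nat \<Rightarrow> nat" where
  "left_shift x = (\<lambda>n. x (Suc n))"

definition birkhoff_sum :: "nat \<Rightarrow> ((nat \<Rightarrow> nat) \<Rightarrow> real) \<Rightarrow> (nat \<Rightarrow> nat) \<Rightarrow> real" where
  "birkhoff_sum n u x = (\<Sum>j<n. u ((left_shift ^^ j) x))"

text \<open>
  Real-valued pressure. The suprema, the sum and the limit are finite for summable potentials in
  \<open>holder_space\<close> below, the only ones for which the pressure is used.
\<close>

definition pressure ::
    "nat set \<Rightarrow> (nat \<Rightarrow> nat \<Rightarrow> bool) \<Rightarrow> ((nat \<Rightarrow> nat) \<Rightarrow> real) \<Rightarrow> real" where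
  "pressure I A u =
     lim (\<lambda>n. 1 / real n *
       ln (\<Sum>\<^sub>\<infinity>\<omega>\<in>words I A n. exp (SUP \<tau>\<in>cylinder I A \<omega>. birkhoff_sum n u \<tau>)))"

definition variation ::
    "nat set \<Rightarrow> (nat \<Rightarrow> nat \<Rightarrow> bool) \<Rightarrow> nat \<Rightarrow> ((nat \<Rightarrow> nat) \<Rightarrow> complex) \<Rightarrow> ennreal" where
  "variation I A n f =
     (SUP (x, y) \<in> {(x, y). x \<in> shift_space I A \<and> y \<in> shift_space I A \<and> (\<forall>i<n. x i = y i)}.
        ennreal (norm (f x - f y)))"

definition holder_seminorm ::
    "nat set \<Rightarrow> (nat \<Rightarrow> nat \<Rightarrow> bool) \<Rightarrow> real \<Rightarrow> ((nat \<Rightarrow> nat) \<Rightarrow> complex) \<Rightarrow> ennreal" where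
  "holder_seminorm I A \<theta> f = (SUP n\<in>{1..}. variation I A n f / ennreal (\<theta> ^ n))"

definition holder_space ::
    "nat set \<Rightarrow> (nat \<Rightarrow> nat \<Rightarrow> bool) \<Rightarrow> real \<Rightarrow> ((nat \<Rightarrow> nat) \<Rightarrow> complex) set" where
  "holder_space I A \<theta> = {f. continuous_on (shift_space I A) f \<and> holder_seminorm I A \<theta> f < \<infinity>}"

text \<open>
  The elements of the Banach spaces on which operators act are represented by their extension by 0
  to all of \<open>nat \<Rightarrow> nat\<close>, so that equality of functions on \<open>E\<^sup>\<infinity>\<close> is equality in HOL. No such
  normalisation is imposed on potentials in \<open>holder_space\<close>, whose values off \<open>E\<^sup>\<infinity>\<close> are irrelevant.
\<close>

definition bounded_cont_space ::
    "nat set \<Rightarrow> (nat \<Rightarrow> nat \<Rightarrow> bool) \<Rightarrow> ((nat \<Rightarrow> nat) \<Rightarrow> complex) set" where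
  "bounded_cont_space I A =
     {g. continuous_on (shift_space I A) g \<and> bounded (g ` shift_space I A) \<and>
         (\<forall>x. x \<notin> shift_space I A \<longrightarrow> g x = 0)}"

definition bounded_holder_space ::
    "nat set \<Rightarrow> (nat \<Rightarrow> nat \<Rightarrow> bool) \<Rightarrow> real \<Rightarrow> ((nat \<Rightarrow> nat) \<Rightarrow> complex) set" where
  "bounded_holder_space I A \<theta> = holder_space I A \<theta> \<inter> bounded_cont_space I A"

definition bounded_holder_norm ::
    "nat set \<Rightarrow> (nat \<Rightarrow> nat \<Rightarrow> bool) \<Rightarrow> real \<Rightarrow> ((nat \<Rightarrow> nat) \<Rightarrow> complex) \<Rightarrow> real" where
  "bounded_holder_norm I A \<theta> g =
     enn2real (holder_seminorm I A \<theta> g) + (SUP x\<in>shift_space I A. norm (g x))"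

definition summable_potential ::
    "nat set \<Rightarrow> (nat \<Rightarrow> nat \<Rightarrow> bool) \<Rightarrow> ((nat \<Rightarrow> nat) \<Rightarrow> real) \<Rightarrow> bool" where
  "summable_potential I A u \<longleftrightarrow> (\<lambda>e. exp (SUP \<tau>\<in>cylinder I A [e]. u \<tau>)) summable_on I"

definition transfer_op ::
    "nat set \<Rightarrow> (nat \<Rightarrow> nat \<Rightarrow> bool) \<Rightarrow> ((nat \<Rightarrow> nat) \<Rightarrow> complex) \<Rightarrow>
     ((nat \<Rightarrow> nat) \<Rightarrow> complex) \<Rightarrow> (nat \<Rightarrow> nat) \<Rightarrow> complex" where
  "transfer_op I A f g \<omega> =
     (\<Sum>\<^sub>\<infinity>y\<in>{y \<in> shift_space I A. left_shift y = \<omega>}. exp (f y) * g y)"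

text \<open>The operator is compatible with the representation by extension by 0.\<close>

lemma transfer_op_outside: "\<omega> \<notin> shift_space I A \<Longrightarrow> transfer_op I A f g \<omega> = 0"
proof -
  assume "\<omega> \<notin> shift_space I A"
  then have "{y \<in> shift_space I A. left_shift y = \<omega>} = {}"
    by (auto simp: shift_space_def left_shift_def)
  then show ?thesis by (simp only: transfer_op_def infsum_empty)
qed

text \<open>Operators on a complex linear space \<open>X\<close> of functions, with norm \<open>N\<close> and pointwise operations.\<close>

definition eigenvalue_on ::
    "('s \<Rightarrow> complex) set \<Rightarrow> (('s \<Rightarrow> complex) \<Rightarrow> 's \<Rightarrow> complex) \<Rightarrow> complex \<Rightarrow> bool" where
  "eigenvalue_on X T z \<longleftrightarrow> (\<exists>g\<in>X. g \<noteq> (\<lambda>x. 0) \<and> T g = (\<lambda>x. z * g x))"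

definition bounded_operator_on ::
    "('s \<Rightarrow> complex) set \<Rightarrow> (('s \<Rightarrow> complex) \<Rightarrow> real) \<Rightarrow> (('s \<Rightarrow> complex) \<Rightarrow> 's \<Rightarrow> complex) \<Rightarrow> bool"
  where
  "bounded_operator_on X N T \<longleftrightarrow>
     (\<forall>g\<in>X. T g \<in> X) \<and>
     (\<forall>g\<in>X. \<forall>h\<in>X. T (\<lambda>x. g x + h x) = (\<lambda>x. T g x + T h x)) \<and>
     (\<forall>g\<in>X. \<forall>c. T (\<lambda>x. c * g x) = (\<lambda>x. c * T g x)) \<and>
     (\<exists>K. \<forall>g\<in>X. N (T g) \<le> K * N g)"

definition spectrum_on ::
    "('s \<Rightarrow> complex) set \<Rightarrow> (('s \<Rightarrow> complex) \<Rightarrow> real) \<Rightarrow> (('s \<Rightarrow> complex) \<Rightarrow> 's \<Rightarrow> complex) \<Rightarrow> complex set"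
  where
  "spectrum_on X N T =
     {z. \<not> (\<exists>R. bounded_operator_on X N R \<and>
            (\<forall>g\<in>X. R (\<lambda>x. z * g x - T g x) = g \<and> (\<lambda>x. z * R g x - T (R g) x) = g))}"

definition a_function ::
    "nat set \<Rightarrow> (nat \<Rightarrow> nat \<Rightarrow> bool) \<Rightarrow> real \<Rightarrow> ((nat \<Rightarrow> nat) \<Rightarrow> complex) \<Rightarrow> bool" where
  "a_function I A a f \<longleftrightarrow>
     eigenvalue_on (bounded_cont_space I A) (transfer_op I A f)
       (exp (\<i> * complex_of_real a + complex_of_real (pressure I A (\<lambda>x. Re (f x)))))"

definition regular_potential ::
    "nat set \<Rightarrow> (nat \<Rightarrow> nat \<Rightarrow> bool) \<Rightarrow> ((nat \<Rightarrow> nat) \<Rightarrow> complex) \<Rightarrow> bool" where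
  "regular_potential I A f \<longleftrightarrow> (\<forall>a. 0 \<le> a \<and> a < 2 * pi \<longrightarrow> \<not> a_function I A a f)"

end

theory Submission
  imports Defs "HOL-Complex_Analysis.Great_Picard" "HOL-Real_Asymp.Real_Asymp"
    "HOL-Library.Omega_Words_Fun"
begin

text \<open>
  Write \<open>T\<close> for the transfer operator, \<open>\<rho> = exp P(u)\<close>, and \<open>Z n\<close> for the sum of
  \<open>exp (sup S\<^sub>n u)\<close> over the words of length \<open>n\<close>, so that \<open>\<rho>\<close> is the limit of the \<open>n\<close>-th roots of
  \<open>Z n\<close>. The theorem is a consequence of quasi-compactness. On an infinite alphabet the shift space
  is not compact, so the inclusion of the Hoelder space in the bounded continuous functions is not a
  compact map; what replaces this is that the weights of the words are summable. Choose one point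
  \<open>\<tau> w\<close> in each cylinder of length \<open>n\<close>. Replacing \<open>g\<close> on each cylinder by its value at \<open>\<tau> w\<close> costs
  at most \<open>\<theta> ^ n\<close> times the Hoelder constant of \<open>g\<close>, which together with bounded distortion of
  Birkhoff sums gives
  \<open>N (T\<^sup>n g) \<le> C (Z n \<theta> ^ n N g + (\<Sum>w. weight w * \<bar>g (\<tau> w)\<bar>))\<close>.
  Since \<open>Z n \<theta> ^ n\<close> is small compared with \<open>\<rho> ^ n\<close> for large \<open>n\<close>, and since by summability all but
  finitely many words contribute only a small multiple of \<open>N g\<close>, there is a number \<open>n\<close> and a finite
  set \<open>F\<close> of points with
  \<open>N (T\<^sup>n g) \<le> (1/2) \<rho> ^ n N g + B * (\<Sum>d\<in>F. \<bar>g d\<bar>)\<close>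
  (lemmas \<open>lasota_yorke\<close> and \<open>eventual_contraction\<close>).

  From here on the argument is abstract and uses neither Riesz theory nor spectral projections. Let
  \<open>g\<^sub>k\<close> be unit vectors with \<open>w g\<^sub>k - T g\<^sub>k \<rightarrow> 0\<close>, where \<open>\<bar>w\<bar> \<ge> \<rho>\<close>. Along a subsequence the values at
  the points of \<open>F\<close> converge, the inequality applied to differences shows that this subsequence is
  Cauchy in norm, and its limit is an eigenvector for \<open>w\<close>. So if no \<open>w\<close> with \<open>\<bar>w\<bar> \<ge> \<rho>\<close> is an
  eigenvalue, there are \<open>r < \<rho>\<close> and \<open>K\<close> with \<open>N g \<le> K * N (w g - T g)\<close> for all \<open>g\<close> and all
  \<open>\<bar>w\<bar> \<ge> r\<close>. Surjectivity of \<open>w - T\<close> is clear for large \<open>w\<close>, and with this uniform bound it is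
  carried inwards along rays by the method of continuity (lemma \<open>spectrum_in_smaller_disc\<close>).

  An eigenvalue of modulus greater than \<open>\<rho>\<close> is excluded by \<open>\<bar>T\<^sup>n g\<bar> \<le> Z n * sup \<bar>g\<bar>\<close>, and one of
  modulus \<open>\<rho>\<close> by regularity. Irreducibility enters through the pressure: it provides a periodic
  point, hence an exponential lower bound for \<open>Z n\<close>, and then Fekete's lemma shows that the limit
  defining \<open>P(u)\<close> exists.
\<close>

section \<open>Complete normed spaces of functions\<close>

lemma null_sequence_if_le:
  fixes a b :: "nat \<Rightarrow> real"
  assumes "\<And>k. 0 \<le> a k" "\<And>k. a k \<le> b k" "b \<longlonglongrightarrow> 0"
  shows "a \<longlonglongrightarrow> 0"
  using assms by (intro tendsto_sandwich[of "\<lambda>_. 0" a sequentially b 0]) auto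

text \<open>
  The space depends on parameters, so it is a set of functions with a norm on it and not a type. The
  last assumption, closedness of balls under pointwise limits, holds whenever the norm is built from
  suprema of pointwise expressions; as evaluations are continuous, it implies completeness.
\<close>

locale normed_function_space =
  fixes X :: "('s \<Rightarrow> complex) set" and N :: "('s \<Rightarrow> complex) \<Rightarrow> real"
  assumes zero_mem: "(\<lambda>x. 0) \<in> X"
    and add_mem: "g \<in> X \<Longrightarrow> h \<in> X \<Longrightarrow> (\<lambda>x. g x + h x) \<in> X"
    and scale_mem: "g \<in> X \<Longrightarrow> (\<lambda>x. c * g x) \<in> X"
    and norm_add_le: "g \<in> X \<Longrightarrow> h \<in> X \<Longrightarrow> N (\<lambda>x. g x + h x) \<le> N g + N h"
    and norm_scale: "g \<in> X \<Longrightarrow> N (\<lambda>x. c * g x) = norm c * N g"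
    and eval_le: "g \<in> X \<Longrightarrow> norm (g x) \<le> N g"
    and fatou: "\<lbrakk>\<And>k::nat. G k \<in> X; \<And>k. N (G k) \<le> C; \<And>x. (\<lambda>k. G k x) \<longlonglongrightarrow> g x\<rbrakk>
                 \<Longrightarrow> g \<in> X \<and> N g \<le> C"
begin

lemma norm_nonneg: "g \<in> X \<Longrightarrow> 0 \<le> N g"
  using eval_le[of g] norm_ge_zero order_trans by blast

lemma norm_zero: "N (\<lambda>x. 0) = 0"
  using norm_scale[OF zero_mem, of 0] by simp

lemma norm_eq_zero: "g \<in> X \<Longrightarrow> N g = 0 \<Longrightarrow> g = (\<lambda>x. 0)"
  using eval_le[of g] by fastforce

lemma diff_mem: "g \<in> X \<Longrightarrow> h \<in> X \<Longrightarrow> (\<lambda>x. g x - h x) \<in> X"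
  using add_mem[OF _ scale_mem[of h "-1"], of g] by simp

lemma norm_diff_le: "g \<in> X \<Longrightarrow> h \<in> X \<Longrightarrow> N (\<lambda>x. g x - h x) \<le> N g + N h"
  using norm_add_le[OF _ scale_mem[of h "-1"], of g] norm_scale[of h "-1"] by simp

lemma N_minus_commute: "g \<in> X \<Longrightarrow> h \<in> X \<Longrightarrow> N (\<lambda>x. g x - h x) = N (\<lambda>x. h x - g x)"
  using norm_scale[OF diff_mem, of g h "-1"] by simp

lemma complete:
  assumes G: "\<And>k::nat. G k \<in> X"
    and cauchy: "\<And>e. 0 < e \<Longrightarrow> \<exists>M. \<forall>m\<ge>M. \<forall>n\<ge>M. N (\<lambda>x. G m x - G n x) < e"
  obtains g where "g \<in> X" "(\<lambda>k. N (\<lambda>x. G k x - g x)) \<longlonglongrightarrow> 0"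
proof -
  have "convergent (\<lambda>k. G k x)" for x
  proof -
    have "Cauchy (\<lambda>k. G k x)"
    proof (rule metric_CauchyI)
      fix e :: real assume "0 < e"
      from cauchy[OF this] obtain M where "\<forall>m\<ge>M. \<forall>n\<ge>M. N (\<lambda>x. G m x - G n x) < e" by blast
      then show "\<exists>M. \<forall>m\<ge>M. \<forall>n\<ge>M. dist (G m x) (G n x) < e"
        using eval_le[OF diff_mem[OF G G]] unfolding dist_norm by (meson order_le_less_trans)
    qed
    then show ?thesis by (simp add: Cauchy_convergent)
  qed
  define g where "g = (\<lambda>x. lim (\<lambda>k. G k x))"
  have lim: "(\<lambda>k. G k x) \<longlonglongrightarrow> g x" for x
    using \<open>\<And>x. convergent (\<lambda>k. G k x)\<close> unfolding g_def by (simp add: convergent_LIMSEQ_iff)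
  have tail: "\<exists>M. \<forall>m\<ge>M. (\<lambda>x. G m x - g x) \<in> X \<and> N (\<lambda>x. G m x - g x) \<le> e" if "0 < e" for e
  proof -
    from cauchy[OF that] obtain M where M: "\<forall>m\<ge>M. \<forall>n\<ge>M. N (\<lambda>x. G m x - G n x) < e" by blast
    \<comment> \<open>The tail of the sequence, seen from its \<open>m\<close>-th term, stays in the ball of radius \<open>e\<close>.\<close>
    have "(\<lambda>x. G m x - g x) \<in> X \<and> N (\<lambda>x. G m x - g x) \<le> e" if "m \<ge> M" for m
    proof (rule fatou[where G = "\<lambda>k x. G m x - G (k + M) x"])
      show "(\<lambda>k. G m x - G (k + M) x) \<longlonglongrightarrow> G m x - g x" for x
        by (intro tendsto_diff tendsto_const LIMSEQ_ignore_initial_segment lim)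
    qed (use M that G diff_mem in \<open>auto intro: less_imp_le\<close>)
    then show ?thesis by blast
  qed
  show thesis
  proof
    from tail[of 1] obtain m where "(\<lambda>x. G m x - g x) \<in> X" by auto
    from diff_mem[OF G[of m] this] show gX: "g \<in> X" by simp
    show "(\<lambda>k. N (\<lambda>x. G k x - g x)) \<longlonglongrightarrow> 0"
    proof (rule LIMSEQ_I)
      fix e :: real assume "0 < e"
      with tail[of "e/2"] obtain M where M: "\<forall>m\<ge>M. N (\<lambda>x. G m x - g x) \<le> e/2" by auto
      have "norm (N (\<lambda>x. G m x - g x) - 0) < e" if "m \<ge> M" for m
        using M that norm_nonneg[OF diff_mem[OF G gX], of m] \<open>0 < e\<close> by fastforce
      then show "\<exists>M. \<forall>m\<ge>M. norm (N (\<lambda>x. G m x - g x) - 0) < e" by blast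
    qed
  qed
qed

lemma contraction_fixed_point:
  assumes \<Phi>: "\<And>g. g \<in> X \<Longrightarrow> \<Phi> g \<in> X" and q: "q < 1"
    and contr: "\<And>g h. g \<in> X \<Longrightarrow> h \<in> X \<Longrightarrow> N (\<lambda>x. \<Phi> g x - \<Phi> h x) \<le> q * N (\<lambda>x. g x - h x)"
  obtains g where "g \<in> X" "\<Phi> g = g"
proof -
  \<comment> \<open>Outside \<open>X\<close> the norm of a difference need not even be symmetric, hence the default value.\<close>
  define d where "d = (\<lambda>g h. if g \<in> X \<and> h \<in> X then N (\<lambda>x. g x - h x) else 0)"
  interpret M: Metric_space X d
  proof
    fix g h k assume "g \<in> X" "h \<in> X" "k \<in> X"
    then show "d g k \<le> d g h + d h k"
      using norm_add_le[OF diff_mem[of g h] diff_mem[of h k]] by (simp add: d_def)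
  next
    fix g h assume "g \<in> X" "h \<in> X"
    then show "(d g h = 0) = (g = h)"
      using norm_eq_zero[OF diff_mem[of g h]] norm_zero by (auto simp: d_def fun_eq_iff)
  qed (auto simp: d_def norm_nonneg diff_mem intro: N_minus_commute)
  have "M.mcomplete"
    unfolding M.mcomplete_def
  proof (intro allI impI)
    fix G assume MC: "M.MCauchy G"
    then have G: "\<And>k. G k \<in> X" by (auto simp: M.MCauchy_def)
    have "\<exists>M. \<forall>m\<ge>M. \<forall>n\<ge>M. N (\<lambda>x. G m x - G n x) < e" if "0 < e" for e
      using MC that G unfolding M.MCauchy_def by (auto simp: d_def)
    from complete[OF G this] obtain g where
      g: "g \<in> X" "(\<lambda>k. N (\<lambda>x. G k x - g x)) \<longlonglongrightarrow> 0" by blast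
    then have "limitin M.mtopology G g sequentially"
      using G unfolding M.limitin_metric_dist_null by (simp add: d_def)
    then show "\<exists>g. limitin M.mtopology G g sequentially"
      by (rule exI[of _ g])
  qed
  moreover have "\<Phi> \<in> X \<rightarrow> X" using \<Phi> by auto
  moreover have "d (\<Phi> g) (\<Phi> h) \<le> q * d g h" if "g \<in> X" "h \<in> X" for g h
    using that \<Phi> contr by (simp add: d_def)
  ultimately obtain g where "g \<in> X" "\<Phi> g = g"
    using M.Banach_fixedpoint_thm[of \<Phi> q] zero_mem q by blast
  then show thesis using that by blast
qed

end

section \<open>Bounded operators and their resolvents\<close>

locale bounded_operator = normed_function_space +
  fixes T :: "('s \<Rightarrow> complex) \<Rightarrow> 's \<Rightarrow> complex"
  assumes bounded_operator: "bounded_operator_on X N T"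
begin

lemma op_mem: "g \<in> X \<Longrightarrow> T g \<in> X"
  and op_add: "g \<in> X \<Longrightarrow> h \<in> X \<Longrightarrow> T (\<lambda>x. g x + h x) = (\<lambda>x. T g x + T h x)"
  and op_scale: "g \<in> X \<Longrightarrow> T (\<lambda>x. c * g x) = (\<lambda>x. c * T g x)"
  using bounded_operator by (auto simp: bounded_operator_on_def)

lemma op_diff: "g \<in> X \<Longrightarrow> h \<in> X \<Longrightarrow> T (\<lambda>x. g x - h x) = (\<lambda>x. T g x - T h x)"
  using op_add[OF _ scale_mem[of h "-1"], of g] op_scale[of h "-1"] by simp

lemma op_bound:
  obtains K where "0 < K" "\<And>g. g \<in> X \<Longrightarrow> N (T g) \<le> K * N g"
proof -
  obtain K where K: "\<forall>g\<in>X. N (T g) \<le> K * N g"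
    using bounded_operator by (auto simp: bounded_operator_on_def)
  have "N (T g) \<le> max K 1 * N g" if "g \<in> X" for g
    using K that mult_right_mono[OF max.cobounded1[of K 1] norm_nonneg[OF that]] by fastforce
  then show thesis using that[of "max K 1"] by simp
qed

lemma op_pow_mem: "g \<in> X \<Longrightarrow> (T ^^ n) g \<in> X"
  by (induction n) (auto intro: op_mem)

lemma op_pow_diff:
  "g \<in> X \<Longrightarrow> h \<in> X \<Longrightarrow> (T ^^ n) (\<lambda>x. g x - h x) = (\<lambda>x. (T ^^ n) g x - (T ^^ n) h x)"
  by (induction n) (auto simp: op_diff op_pow_mem)

lemma resolvent_mem: "g \<in> X \<Longrightarrow> (\<lambda>x. w * g x - T g x) \<in> X"
  by (intro diff_mem scale_mem op_mem)

lemma resolvent_diff: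
  assumes "g \<in> X" "h \<in> X"
  shows "(\<lambda>x. w * (g x - h x) - T (\<lambda>x. g x - h x) x)
       = (\<lambda>x. (w * g x - T g x) - (w * h x - T h x))"
  by (simp add: op_diff[OF assms] algebra_simps)

lemma resolvent_inj:
  assumes K: "\<And>g. g \<in> X \<Longrightarrow> N g \<le> K * N (\<lambda>x. w * g x - T g x)"
    and gh: "g \<in> X" "h \<in> X" "(\<lambda>x. w * g x - T g x) = (\<lambda>x. w * h x - T h x)"
  shows "g = h"
proof -
  have "(\<lambda>x. w * (g x - h x) - T (\<lambda>x. g x - h x) x) = (\<lambda>x. 0)"
    unfolding resolvent_diff[OF gh(1,2)] using gh(3) by (auto simp: fun_eq_iff)
  then have "N (\<lambda>x. g x - h x) = 0"
    using K[OF diff_mem[OF gh(1,2)]] norm_nonneg[OF diff_mem[OF gh(1,2)]] norm_zero by auto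
  from norm_eq_zero[OF diff_mem[OF gh(1,2)] this] show "g = h"
    by (auto simp: fun_eq_iff)
qed

lemma not_in_spectrumI:
  assumes K: "\<And>g. g \<in> X \<Longrightarrow> N g \<le> K * N (\<lambda>x. w * g x - T g x)"
    and surj: "\<And>h. h \<in> X \<Longrightarrow> \<exists>g\<in>X. (\<lambda>x. w * g x - T g x) = h"
  shows "w \<notin> spectrum_on X N T"
proof -
  from surj obtain R where
    R: "\<And>h. h \<in> X \<Longrightarrow> R h \<in> X" "\<And>h. h \<in> X \<Longrightarrow> (\<lambda>x. w * R h x - T (R h) x) = h"
    by metis
  have uniq: "R h = g" if "g \<in> X" "h \<in> X" "(\<lambda>x. w * g x - T g x) = h" for g h
    using resolvent_inj[OF K R(1)[OF that(2)] that(1)] R(2)[OF that(2)] that(3) by simp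
  have app: "w * R h x - T (R h) x = h x" if "h \<in> X" for h x
    using R(2)[OF that] by (rule fun_cong)
  have "bounded_operator_on X N R"
    unfolding bounded_operator_on_def
  proof (intro conjI ballI allI exI)
    fix g h assume g: "g \<in> X" and h: "h \<in> X"
    have "(\<lambda>x. w * (R g x + R h x) - T (\<lambda>x. R g x + R h x) x)
        = (\<lambda>x. (w * R g x - T (R g) x) + (w * R h x - T (R h) x))"
      by (simp add: op_add R(1) g h algebra_simps)
    then show "R (\<lambda>x. g x + h x) = (\<lambda>x. R g x + R h x)"
      unfolding app[OF g] app[OF h] by (intro uniq add_mem R(1) g h)
  next
    fix g c assume g: "g \<in> X"
    have "(\<lambda>x. w * (c * R g x) - T (\<lambda>x. c * R g x) x) = (\<lambda>x. c * (w * R g x - T (R g) x))"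
      by (simp add: op_scale R(1) g algebra_simps)
    then show "R (\<lambda>x. c * g x) = (\<lambda>x. c * R g x)"
      unfolding app[OF g] by (intro uniq scale_mem R(1) g)
    show "N (R g) \<le> K * N g"
      using K[OF R(1)[OF g]] unfolding R(2)[OF g] .
  qed (use R in auto)
  moreover have "R (\<lambda>x. w * g x - T g x) = g" if "g \<in> X" for g
    using uniq[OF that resolvent_mem[OF that] refl] .
  ultimately show ?thesis
    unfolding spectrum_on_def using R(2) by blast
qed

text \<open>
  With \<open>R\<close> a right inverse of \<open>w - T\<close>, every solution of \<open>g = R (h + (w - z) g)\<close> satisfies
  \<open>(z - T) g = h\<close>. The lower bound makes \<open>R\<close> Lipschitz with constant \<open>K\<close>, so for \<open>z\<close> close to \<open>w\<close>
  the right-hand side is a contraction.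
\<close>

lemma surjective_step:
  assumes K: "\<And>g. g \<in> X \<Longrightarrow> N g \<le> K * N (\<lambda>x. w * g x - T g x)"
    and surj: "\<And>h. h \<in> X \<Longrightarrow> \<exists>g\<in>X. (\<lambda>x. w * g x - T g x) = h"
    and close: "K * norm (z - w) < 1" and "0 \<le> K" and h: "h \<in> X"
  shows "\<exists>g\<in>X. (\<lambda>x. z * g x - T g x) = h"
proof -
  from surj obtain R where
    R: "\<And>h. h \<in> X \<Longrightarrow> R h \<in> X" "\<And>h. h \<in> X \<Longrightarrow> (\<lambda>x. w * R h x - T (R h) x) = h"
    by metis
  define \<Phi> where "\<Phi> = (\<lambda>g. R (\<lambda>x. h x + (w - z) * g x))"
  have mem: "(\<lambda>x. h x + (w - z) * g x) \<in> X" if "g \<in> X" for g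
    using that h by (intro add_mem scale_mem)
  have app: "w * \<Phi> g x - T (\<Phi> g) x = h x + (w - z) * g x" if "g \<in> X" for g x
    unfolding \<Phi>_def using R(2)[OF mem[OF that]] by (rule fun_cong)
  have "N (\<lambda>x. \<Phi> g x - \<Phi> k x) \<le> (K * norm (z - w)) * N (\<lambda>x. g x - k x)"
    if g: "g \<in> X" and k: "k \<in> X" for g k
  proof -
    have X: "\<Phi> g \<in> X" "\<Phi> k \<in> X" unfolding \<Phi>_def by (intro R mem that)+
    have "(\<lambda>x. w * (\<Phi> g x - \<Phi> k x) - T (\<lambda>x. \<Phi> g x - \<Phi> k x) x)
        = (\<lambda>x. (w - z) * (g x - k x))"
      unfolding resolvent_diff[OF X] app[OF g] app[OF k] by (simp add: algebra_simps)
    with K[OF diff_mem[OF X]] show ?thesis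
      using norm_scale[OF diff_mem[OF g k], of "w - z"] by (simp add: norm_minus_commute[of z w] mult.assoc)
  qed
  moreover have "\<Phi> g \<in> X" if "g \<in> X" for g unfolding \<Phi>_def by (intro R mem that)
  ultimately obtain g where g: "g \<in> X" "\<Phi> g = g"
    using contraction_fixed_point[OF _ close, of \<Phi>] by blast
  have "(\<lambda>x. w * g x - T g x) = (\<lambda>x. h x + (w - z) * g x)"
    using R(2)[OF mem[OF g(1)]] g(2) by (simp add: \<Phi>_def)
  then have "(\<lambda>x. z * g x - T g x) = h"
    by (auto simp: fun_eq_iff algebra_simps)
  with g show ?thesis by blast
qed

text \<open>
  Here \<open>w g - T g = h\<close> reads \<open>g = (h + T g) / w\<close>, a contraction because \<open>T\<close> is bounded by
  \<open>K < \<bar>w\<bar>\<close>.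
\<close>

lemma surjective_outside_bound:
  assumes K: "\<And>g. g \<in> X \<Longrightarrow> N (T g) \<le> K * N g" "0 < K" and w: "K < norm w" and h: "h \<in> X"
  shows "\<exists>g\<in>X. (\<lambda>x. w * g x - T g x) = h"
proof -
  have w0: "w \<noteq> 0" using w K by auto
  define \<Phi> where "\<Phi> = (\<lambda>g x. (1 / w) * (h x + T g x))"
  have mem: "\<Phi> g \<in> X" if "g \<in> X" for g
    unfolding \<Phi>_def using that h by (intro scale_mem add_mem op_mem)
  have "N (\<lambda>x. \<Phi> g x - \<Phi> k x) \<le> (K / norm w) * N (\<lambda>x. g x - k x)"
    if g: "g \<in> X" and k: "k \<in> X" for g k
  proof -
    have "(\<lambda>x. \<Phi> g x - \<Phi> k x) = (\<lambda>x. (1 / w) * T (\<lambda>x. g x - k x) x)"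
      unfolding op_diff[OF g k] \<Phi>_def by (auto simp: algebra_simps)
    then have "N (\<lambda>x. \<Phi> g x - \<Phi> k x) = N (T (\<lambda>x. g x - k x)) / norm w"
      using norm_scale[OF op_mem[OF diff_mem[OF g k]], of "1/w"] by (simp add: norm_divide)
    then show ?thesis using K(1)[OF diff_mem[OF g k]] w0 by (simp add: divide_right_mono)
  qed
  moreover have "K / norm w < 1" using w w0 by simp
  ultimately obtain g where g: "g \<in> X" "\<Phi> g = g"
    using contraction_fixed_point[of \<Phi> "K / norm w"] mem by blast
  have "w * g x = h x + T g x" for x
    using fun_cong[OF g(2), of x] w0 by (auto simp: \<Phi>_def field_simps)
  then show ?thesis using g(1) by (auto intro!: bexI[of _ g])
qed

text \<open>
  A large multiple of \<open>z\<close> is covered by the previous lemma. From there \<open>z\<close> is reached along the ray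
  through \<open>z\<close>, which never comes closer to the origin than \<open>z\<close> does; the step length allowed by
  \<open>surjective_step\<close> depends on \<open>K\<close> only, so finitely many steps suffice.
\<close>

lemma method_of_continuity:
  assumes K: "\<And>w g. r \<le> norm w \<Longrightarrow> g \<in> X \<Longrightarrow> N g \<le> K * N (\<lambda>x. w * g x - T g x)"
    and K0: "0 < K" and r: "0 < r" and z: "r \<le> norm z" and "h \<in> X"
  shows "\<exists>g\<in>X. (\<lambda>x. z * g x - T g x) = h"
proof -
  obtain L where L: "0 < L" "\<And>g. g \<in> X \<Longrightarrow> N (T g) \<le> L * N g" using op_bound by blast
  \<comment> \<open>Consecutive points \<open>p k\<close> are at distance \<open>\<delta> * norm z = 1 / (2 * K)\<close>.\<close>
  define \<delta> where "\<delta> = 1 / (2 * K * norm z)"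
  have z0: "0 < norm z" using r z by linarith
  have \<delta>: "0 < \<delta>" using K0 z0 by (simp add: \<delta>_def)
  define p where "p = (\<lambda>k::nat. complex_of_real (1 + real k * \<delta>) * z)"
  have ge: "r \<le> norm (p k)" for k
  proof -
    have "norm z \<le> (1 + real k * \<delta>) * norm z" using \<delta> z0 by (simp add: algebra_simps)
    also have "\<dots> = norm (p k)" using \<delta> by (simp add: p_def norm_mult del: of_real_add)
    finally show ?thesis using z by linarith
  qed
  have descend: "(\<forall>h\<in>X. \<exists>g\<in>X. (\<lambda>x. p k * g x - T g x) = h) \<Longrightarrow>
                 (\<forall>h\<in>X. \<exists>g\<in>X. (\<lambda>x. p 0 * g x - T g x) = h)" for k
  proof (induction k)
    case (Suc k)
    have "K * norm (p k - p (Suc k)) = 1 / 2"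
    proof -
      have "p k - p (Suc k) = - complex_of_real \<delta> * z" by (simp add: p_def algebra_simps)
      then have "norm (p k - p (Suc k)) = \<delta> * norm z" using \<delta> by (simp add: norm_mult)
      then show ?thesis using K0 z0 by (simp add: \<delta>_def)
    qed
    then have "\<exists>g\<in>X. (\<lambda>x. p k * g x - T g x) = h" if "h \<in> X" for h
      using surjective_step[OF K[OF ge[of "Suc k"]], of "p k" h] Suc.prems K0 that by simp
    then show ?case using Suc.IH by blast
  qed simp
  obtain k :: nat where "L / (\<delta> * norm z) < real k" using reals_Archimedean2 by blast
  then have "L < real k * \<delta> * norm z" using \<delta> z0 by (simp add: field_simps)
  also have "\<dots> \<le> (1 + real k * \<delta>) * norm z" using z0 by (simp add: algebra_simps)
  also have "\<dots> = norm (p k)" using \<delta> by (simp add: p_def norm_mult del: of_real_add)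
  finally have "\<forall>h\<in>X. \<exists>g\<in>X. (\<lambda>x. p k * g x - T g x) = h"
    using surjective_outside_bound[OF L(2) L(1)] by blast
  from descend[OF this] show ?thesis using \<open>h \<in> X\<close> by (simp add: p_def)
qed

section \<open>Spectral gap from a compactness estimate\<close>

text \<open>
  Up to null sequences, \<open>T ^^ n\<close> acts on the differences \<open>g k - g l\<close> as multiplication by \<open>w ^ n\<close>.
  As \<open>q < 1\<close>, the first term of the estimate can be absorbed on the left, and
  \<open>N (g k - g l)\<close> is controlled by the finitely many values \<open>g k d - g l d\<close>, which tend to 0 along a
  subsequence by Bolzano-Weierstrass. The limit in norm is the required eigenvector; it is not 0
  because the \<open>g k\<close> are unit vectors.
\<close>

lemma approximate_eigenvectors_imp_eigenvalue:
  assumes g: "\<And>k::nat. g k \<in> X" "\<And>k. N (g k) = 1"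
    and approx: "(\<lambda>k. N (\<lambda>x. w * g k x - T (g k) x)) \<longlonglongrightarrow> 0"
    and w: "\<rho> \<le> norm w" and \<rho>: "0 < \<rho>" and F: "finite F" and q: "q < 1" and B: "0 \<le> B"
    and LY: "\<And>g. g \<in> X \<Longrightarrow> N ((T ^^ n) g) \<le> q * \<rho> ^ n * N g + B * (\<Sum>d\<in>F. norm (g d))"
  shows "eigenvalue_on X T w"
proof -
  obtain K where K: "0 < K" "\<And>g. g \<in> X \<Longrightarrow> N (T g) \<le> K * N g" using op_bound by blast
  \<comment> \<open>Telescoping: \<open>w ^ (m + 1) - T ^ (m + 1) = w ^ m (w - T) + T (w ^ m - T ^ m)\<close>.\<close>
  have pow: "(\<lambda>k. N (\<lambda>x. w ^ m * g k x - (T ^^ m) (g k) x)) \<longlonglongrightarrow> 0" for m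
  proof (induction m)
    case 0
    then show ?case by (simp add: norm_zero)
  next
    case (Suc m)
    have "N (\<lambda>x. w ^ Suc m * g k x - (T ^^ Suc m) (g k) x)
        \<le> norm (w ^ m) * N (\<lambda>x. w * g k x - T (g k) x)
          + K * N (\<lambda>x. w ^ m * g k x - (T ^^ m) (g k) x)" for k
    proof -
      have X: "(\<lambda>x. w ^ m * g k x) \<in> X" "(T ^^ m) (g k) \<in> X"
        by (intro scale_mem op_pow_mem g)+
      have "N (\<lambda>x. w ^ Suc m * g k x - (T ^^ Suc m) (g k) x)
          = N (\<lambda>x. w ^ m * (w * g k x - T (g k) x) + T (\<lambda>x. w ^ m * g k x - (T ^^ m) (g k) x) x)"
        using op_diff[OF X] op_scale[OF g(1)] by (simp add: algebra_simps)
      also have "\<dots> \<le> N (\<lambda>x. w ^ m * (w * g k x - T (g k) x))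
                     + N (T (\<lambda>x. w ^ m * g k x - (T ^^ m) (g k) x))"
        by (intro norm_add_le scale_mem resolvent_mem op_mem diff_mem X g)
      also have "\<dots> \<le> norm (w ^ m) * N (\<lambda>x. w * g k x - T (g k) x)
                     + K * N (\<lambda>x. w ^ m * g k x - (T ^^ m) (g k) x)"
        by (rule add_mono[OF eq_refl[OF norm_scale[OF resolvent_mem[OF g(1)]]] K(2)[OF diff_mem[OF X]]])
      finally show ?thesis .
    qed
    moreover have "(\<lambda>k. norm (w ^ m) * N (\<lambda>x. w * g k x - T (g k) x)
          + K * N (\<lambda>x. w ^ m * g k x - (T ^^ m) (g k) x)) \<longlonglongrightarrow> 0"
      using tendsto_add[OF tendsto_mult_left[OF approx, of "norm (w ^ m)"] tendsto_mult_left[OF Suc.IH, of K]]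
      by simp
    ultimately show ?case
      by (intro null_sequence_if_le[OF norm_nonneg[OF diff_mem[OF scale_mem op_pow_mem]]] g)
  qed
  have bdd: "norm (g k d) \<le> 1" for k d using eval_le[OF g(1), of k d] g(2)[of k] by simp
  obtain s :: "nat \<Rightarrow> nat" where s: "strict_mono s"
    and conv: "\<And>d. d \<in> F \<Longrightarrow> \<exists>l. (\<lambda>k. g (s k) d) \<longlonglongrightarrow> l"
    using function_convergent_subsequence[of F g 1] countable_finite[OF F] bdd by metis
  define a where "a = (\<lambda>k. N (\<lambda>x. w ^ n * g (s k) x - (T ^^ n) (g (s k)) x))"
  have a: "a \<longlonglongrightarrow> 0" unfolding a_def using LIMSEQ_subseq_LIMSEQ[OF pow s] by (simp add: o_def)
  define c where "c = (1 - q) * \<rho> ^ n"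
  have c: "0 < c" using q \<rho> by (simp add: c_def)
  have main: "c * N (\<lambda>x. g (s k) x - g (s l) x)
      \<le> a k + a l + B * (\<Sum>d\<in>F. norm (g (s k) d - g (s l) d))" for k l
  proof -
    let ?h = "\<lambda>x. g (s k) x - g (s l) x"
    have h: "?h \<in> X" by (intro diff_mem g)
    have Xk: "(\<lambda>x. w ^ n * g j x - (T ^^ n) (g j) x) \<in> X" for j
      by (intro diff_mem scale_mem op_pow_mem g)
    have "\<rho> ^ n * N ?h \<le> norm w ^ n * N ?h"
      using w \<rho> norm_nonneg[OF h] by (intro mult_right_mono power_mono) auto
    also have "\<dots> = N (\<lambda>x. w ^ n * ?h x)" using norm_scale[OF h] by (simp add: norm_power)
    also have "N (\<lambda>x. w ^ n * ?h x) = N (\<lambda>x. ((w ^ n * g (s k) x - (T ^^ n) (g (s k)) x)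
          - (w ^ n * g (s l) x - (T ^^ n) (g (s l)) x)) + (T ^^ n) ?h x)"
      using op_pow_diff[OF g(1) g(1)] by (simp add: algebra_simps)
    also have "\<dots> \<le> N (\<lambda>x. (w ^ n * g (s k) x - (T ^^ n) (g (s k)) x)
          - (w ^ n * g (s l) x - (T ^^ n) (g (s l)) x)) + N ((T ^^ n) ?h)"
      by (intro norm_add_le diff_mem[OF Xk Xk] op_pow_mem h)
    also have "\<dots> \<le> (a k + a l) + (q * \<rho> ^ n * N ?h + B * (\<Sum>d\<in>F. norm (?h d)))"
      unfolding a_def by (intro add_mono norm_diff_le Xk LY h)
    finally show ?thesis by (simp add: c_def algebra_simps)
  qed
  have "\<exists>M. \<forall>m\<ge>M. \<forall>k\<ge>M. N (\<lambda>x. g (s m) x - g (s k) x) < e" if e: "0 < e" for e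
  proof -
    define S where "S = 1 + B * card F"
    have S: "0 < S" using B by (simp add: S_def add_pos_nonneg)
    define \<epsilon> where "\<epsilon> = c * e / (4 * S)"
    have \<epsilon>: "0 < \<epsilon>" using c e S by (simp add: \<epsilon>_def)
    have "\<forall>\<^sub>F k in sequentially. a k < \<epsilon>"
      using a \<epsilon> by (rule order_tendstoD(2))
    then obtain M1 where M1: "\<And>k. k \<ge> M1 \<Longrightarrow> a k < \<epsilon>" by (auto simp: eventually_sequentially)
    obtain L where L: "\<And>d. d \<in> F \<Longrightarrow> (\<lambda>k. g (s k) d) \<longlonglongrightarrow> L d" using conv by metis
    have "\<forall>\<^sub>F k in sequentially. \<forall>d\<in>F. dist (g (s k) d) (L d) < \<epsilon>"
      using F L \<epsilon> by (intro eventually_ball_finite ballI tendstoD)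
    then obtain M2 where M2: "\<And>k d. k \<ge> M2 \<Longrightarrow> d \<in> F \<Longrightarrow> dist (g (s k) d) (L d) < \<epsilon>"
      by (auto simp: eventually_sequentially)
    have "N (\<lambda>x. g (s m) x - g (s k) x) < e" if "m \<ge> max M1 M2" "k \<ge> max M1 M2" for m k
    proof -
      have "(\<Sum>d\<in>F. norm (g (s m) d - g (s k) d)) \<le> (\<Sum>d\<in>F. 2 * \<epsilon>)"
      proof (rule sum_mono)
        fix d assume d: "d \<in> F"
        have "dist (g (s m) d) (g (s k) d) \<le> 2 * \<epsilon>"
          using M2[of m d] M2[of k d] that d dist_triangle2[of "g (s m) d" "g (s k) d" "L d"] by simp
        then show "norm (g (s m) d - g (s k) d) \<le> 2 * \<epsilon>" by (simp add: dist_norm)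
      qed
      then have "B * (\<Sum>d\<in>F. norm (g (s m) d - g (s k) d)) \<le> B * (card F * (2 * \<epsilon>))"
        using B by (intro mult_left_mono) auto
      then have "c * N (\<lambda>x. g (s m) x - g (s k) x) < \<epsilon> + \<epsilon> + B * (card F * (2 * \<epsilon>))"
        using main[of m k] M1[of m] M1[of k] that by simp
      also have "\<dots> = 2 * S * \<epsilon>" by (simp add: S_def algebra_simps)
      also have "\<dots> = c * e / 2" using S by (simp add: \<epsilon>_def)
      also have "\<dots> < c * e" using c e by simp
      finally show ?thesis using c by simp
    qed
    then show ?thesis by blast
  qed
  from complete[of "\<lambda>k. g (s k)", OF g(1) this]
  obtain h where h: "h \<in> X" "(\<lambda>k. N (\<lambda>x. g (s k) x - h x)) \<longlonglongrightarrow> 0" by blast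
  have "1 \<le> N (\<lambda>x. g (s k) x - h x) + N h" for k
    using norm_add_le[OF diff_mem[OF g(1) h(1)] h(1), of "s k"] g(2)[of "s k"] by simp
  then have "1 \<le> 0 + N h"
    using tendsto_add[OF h(2) tendsto_const[of "N h"]] by (intro LIMSEQ_le_const) auto
  then have "h \<noteq> (\<lambda>x. 0)" using norm_zero by auto
  moreover have "T h = (\<lambda>x. w * h x)"
  proof -
    have "N (\<lambda>x. w * h x - T h x) \<le> N (\<lambda>x. w * g (s k) x - T (g (s k)) x)
           + (norm w + K) * N (\<lambda>x. g (s k) x - h x)" for k
    proof -
      have d: "(\<lambda>x. g (s k) x - h x) \<in> X" by (intro diff_mem g h)
      have "N (\<lambda>x. w * h x - T h x) = N (\<lambda>x. (w * g (s k) x - T (g (s k)) x)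
              - (w * (g (s k) x - h x) - T (\<lambda>x. g (s k) x - h x) x))"
        by (simp add: op_diff g h algebra_simps)
      also have "\<dots> \<le> N (\<lambda>x. w * g (s k) x - T (g (s k)) x)
              + N (\<lambda>x. w * (g (s k) x - h x) - T (\<lambda>x. g (s k) x - h x) x)"
        by (intro norm_diff_le resolvent_mem g d)
      also have "\<dots> \<le> N (\<lambda>x. w * g (s k) x - T (g (s k)) x)
              + (norm w * N (\<lambda>x. g (s k) x - h x) + K * N (\<lambda>x. g (s k) x - h x))"
        using norm_diff_le[OF scale_mem[OF d] op_mem[OF d], of w] norm_scale[OF d, of w] K(2)[OF d] by simp
      finally show ?thesis by (simp add: algebra_simps)
    qed
    moreover have "(\<lambda>k. N (\<lambda>x. w * g (s k) x - T (g (s k)) x)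
           + (norm w + K) * N (\<lambda>x. g (s k) x - h x)) \<longlonglongrightarrow> 0"
      using tendsto_add[OF LIMSEQ_subseq_LIMSEQ[OF approx s] tendsto_mult_left[OF h(2), of "norm w + K"]]
      by (simp add: o_def)
    ultimately have "N (\<lambda>x. w * h x - T h x) \<le> 0" by (intro LIMSEQ_le_const) auto
    then have "(\<lambda>x. w * h x - T h x) = (\<lambda>x. 0)"
      using norm_nonneg[OF resolvent_mem[OF h(1), of w]] by (intro norm_eq_zero resolvent_mem h) auto
    then show ?thesis by (auto simp: fun_eq_iff)
  qed
  ultimately show ?thesis unfolding eigenvalue_on_def using h(1) by blast
qed

text \<open>
  The radii \<open>\<rho> - \<rho> / (k + 2)\<close> increase to \<open>\<rho>\<close> and the constants \<open>k + 1\<close> to infinity. If the lower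
  bound for \<open>w - T\<close> failed for every \<open>k\<close>, normalised counterexamples would be approximate
  eigenvectors for parameters \<open>w k\<close>; these are bounded, as \<open>T\<close> is, and a limit point \<open>w'\<close> has modulus
  at least \<open>\<rho>\<close> and would be an eigenvalue.
\<close>

theorem spectrum_in_smaller_disc:
  assumes \<rho>: "0 < \<rho>" and F: "finite F" and q: "q < 1" and B: "0 \<le> B"
    and LY: "\<And>g. g \<in> X \<Longrightarrow> N ((T ^^ n) g) \<le> q * \<rho> ^ n * N g + B * (\<Sum>d\<in>F. norm (g d))"
    and no_eigenvalue: "\<And>w. \<rho> \<le> norm w \<Longrightarrow> \<not> eigenvalue_on X T w"
  shows "\<exists>r. 0 \<le> r \<and> r < \<rho> \<and> spectrum_on X N T \<subseteq> cball 0 r"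
proof -
  obtain L where L: "0 < L" "\<And>g. g \<in> X \<Longrightarrow> N (T g) \<le> L * N g" using op_bound by blast
  have "\<exists>k::nat. \<forall>w g. \<rho> - \<rho> / (real k + 2) \<le> norm w \<longrightarrow> g \<in> X \<longrightarrow> N g \<le> (real k + 1) * N (\<lambda>x. w * g x - T g x)"
  proof (rule ccontr)
    assume "\<not> ?thesis"
    then have "\<forall>k::nat. \<exists>w g. \<rho> - \<rho> / (real k + 2) \<le> norm w \<and> g \<in> X
        \<and> (real k + 1) * N (\<lambda>x. w * g x - T g x) < N g"
      by (simp only: not_ex not_all not_imp not_le simp_thms)
    from choice[OF this] obtain w :: "nat \<Rightarrow> complex"
      where "\<forall>k::nat. \<exists>g. \<rho> - \<rho> / (real k + 2) \<le> norm (w k) \<and> g \<in> X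
        \<and> (real k + 1) * N (\<lambda>x. w k * g x - T g x) < N g" ..
    from choice[OF this] obtain g :: "nat \<Rightarrow> 's \<Rightarrow> complex"
      where wg: "\<forall>k::nat. \<rho> - \<rho> / (real k + 2) \<le> norm (w k) \<and> g k \<in> X
        \<and> (real k + 1) * N (\<lambda>x. w k * g k x - T (g k) x) < N (g k)" ..
    then have w: "\<rho> - \<rho> / (real k + 2) \<le> norm (w k)" and g: "g k \<in> X"
      and lt: "(real k + 1) * N (\<lambda>x. w k * g k x - T (g k) x) < N (g k)" for k :: nat
      by simp_all
    have pos: "0 < N (g k)" for k
    proof -
      have "0 \<le> (real k + 1) * N (\<lambda>x. w k * g k x - T (g k) x)"
        by (intro mult_nonneg_nonneg norm_nonneg resolvent_mem g) auto
      then show ?thesis using lt[of k] by linarith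
    qed
    define e where "e = (\<lambda>k x. complex_of_real (1 / N (g k)) * g k x)"
    have e: "e k \<in> X" "N (e k) = 1" for k
    proof -
      show "e k \<in> X" unfolding e_def by (intro scale_mem g)
      show "N (e k) = 1"
        using pos[of k] norm_scale[OF g, of "complex_of_real (1 / N (g k))" k] unfolding e_def
        by (simp add: norm_divide)
    qed
    have small: "N (\<lambda>x. w k * e k x - T (e k) x) \<le> inverse (real (Suc k))" for k
    proof -
      have "(\<lambda>x. w k * e k x - T (e k) x)
          = (\<lambda>x. complex_of_real (1 / N (g k)) * (w k * g k x - T (g k) x))"
        unfolding e_def op_scale[OF g] by (simp add: algebra_simps)
      then have "N (\<lambda>x. w k * e k x - T (e k) x) = N (\<lambda>x. w k * g k x - T (g k) x) / N (g k)"
        using norm_scale[OF resolvent_mem[OF g], of "complex_of_real (1 / N (g k))" "w k" k] pos[of k]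
        by (simp add: norm_divide)
      moreover have "N (\<lambda>x. w k * g k x - T (g k) x) / N (g k) \<le> inverse (real (Suc k))"
        using lt[of k] pos[of k] by (simp add: field_simps)
      ultimately show ?thesis by simp
    qed
    have "norm (w k) \<le> 1 + L" for k
    proof -
      have "norm (w k) = N (\<lambda>x. (w k * e k x - T (e k) x) + T (e k) x)"
        using norm_scale[OF e(1), of "w k" k] e(2)[of k] by simp
      also have "\<dots> \<le> N (\<lambda>x. w k * e k x - T (e k) x) + N (T (e k))"
        by (intro norm_add_le resolvent_mem op_mem e)
      also have "\<dots> \<le> 1 + L"
        using small[of k] L(2)[OF e(1), of k] e(2)[of k] inverse_le_1_iff[of "real (Suc k)"] by simp
      finally show ?thesis .
    qed
    then have "bounded (range w)" by (auto simp: bounded_iff)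
    then obtain w' s where s: "strict_mono (s :: nat \<Rightarrow> nat)" and lim: "(w \<circ> s) \<longlonglongrightarrow> w'"
      using bounded_imp_convergent_subsequence by blast
    have "(\<lambda>k::nat. \<rho> - \<rho> / (real k + 2)) \<longlonglongrightarrow> \<rho>" by real_asymp
    from LIMSEQ_subseq_LIMSEQ[OF this s] have "\<rho> \<le> norm w'"
      by (rule LIMSEQ_le[OF _ tendsto_norm[OF lim]]) (use w in auto)
    moreover have "(\<lambda>k. N (\<lambda>x. w' * e (s k) x - T (e (s k)) x)) \<longlonglongrightarrow> 0"
    proof -
      have "N (\<lambda>x. w' * e (s k) x - T (e (s k)) x) \<le> norm (w' - w (s k)) + inverse (real (Suc (s k)))" for k
      proof -
        have "N (\<lambda>x. w' * e (s k) x - T (e (s k)) x)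
           = N (\<lambda>x. (w' - w (s k)) * e (s k) x + (w (s k) * e (s k) x - T (e (s k)) x))"
          by (simp add: algebra_simps)
        also have "\<dots> \<le> N (\<lambda>x. (w' - w (s k)) * e (s k) x) + N (\<lambda>x. w (s k) * e (s k) x - T (e (s k)) x)"
          by (intro norm_add_le scale_mem resolvent_mem e)
        finally show ?thesis using small[of "s k"] norm_scale[OF e(1), of "w' - w (s k)" "s k"] e(2) by simp
      qed
      moreover have "(\<lambda>k. norm (w' - w (s k)) + inverse (real (Suc (s k)))) \<longlonglongrightarrow> norm (w' - w') + 0"
        using lim LIMSEQ_subseq_LIMSEQ[OF LIMSEQ_inverse_real_of_nat s]
        by (intro tendsto_intros) (auto simp: o_def)
      ultimately show ?thesis
        by (intro null_sequence_if_le[OF norm_nonneg[OF resolvent_mem]] e) auto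
    qed
    ultimately have "eigenvalue_on X T w'"
      using e by (intro approximate_eigenvectors_imp_eigenvalue[OF _ _ _ _ \<rho> F q B LY, of "\<lambda>k. e (s k)"]) auto
    then show False using no_eigenvalue \<open>\<rho> \<le> norm w'\<close> by blast
  qed
  then obtain k :: nat where k: "\<And>w g. \<rho> - \<rho> / (real k + 2) \<le> norm w \<Longrightarrow> g \<in> X
      \<Longrightarrow> N g \<le> (real k + 1) * N (\<lambda>x. w * g x - T g x)" by blast
  define r where "r = \<rho> - \<rho> / (real k + 2)"
  have r: "0 < r" "r < \<rho>" using \<rho> by (auto simp: r_def field_simps add_pos_nonneg)
  note K = k[folded r_def]
  have "w \<notin> spectrum_on X N T" if w: "r \<le> norm w" for w
  proof (rule not_in_spectrumI)
    show "N g \<le> (real k + 1) * N (\<lambda>x. w * g x - T g x)" if "g \<in> X" for g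
      using K[OF w that] .
    show "\<exists>g\<in>X. (\<lambda>x. w * g x - T g x) = h" if "h \<in> X" for h
      using method_of_continuity[OF K _ r(1) w that] by simp
  qed
  then have "w \<in> cball 0 r" if "w \<in> spectrum_on X N T" for w
    using that by (cases "r \<le> norm w") auto
  then have "spectrum_on X N T \<subseteq> cball 0 r" by blast
  with r show ?thesis by (auto intro!: exI[of _ r])
qed

end

section \<open>Subadditive sequences and a bound for the exponential\<close>

text \<open>
  Fekete's lemma. Writing \<open>n = q m + r\<close> with \<open>r < m\<close>, subadditivity bounds \<open>p n\<close> by
  \<open>n (p m / m)\<close> up to a constant that depends on \<open>m\<close> only; the limit is the infimum of the quotients.
\<close>

lemma subadditive_quotient_convergent:
  fixes p :: "nat \<Rightarrow> real"
  assumes sub: "\<And>m n. p (m + n) \<le> p m + p n" and lower: "\<And>n. c * real n \<le> p n"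
  shows "convergent (\<lambda>n. p n / real n)"
proof -
  define V where "V = (\<lambda>n. p n / real n) ` {1..}"
  define L where "L = Inf V"
  have "c \<le> p n / real n" if "1 \<le> n" for n
    using lower[of n] that by (simp add: field_simps)
  then have bdd: "bdd_below V" unfolding V_def by (auto intro!: bdd_belowI[of _ c])
  have L_le: "L \<le> p n / real n" if "1 \<le> n" for n
    unfolding L_def using that by (intro cInf_lower bdd) (auto simp: V_def)
  have "(\<lambda>n. p n / real n) \<longlonglongrightarrow> L"
  proof (rule LIMSEQ_I)
    fix e :: real assume e: "0 < e"
    have "\<exists>v\<in>V. v < L + e / 2"
      using cInf_lessD[of V "L + e / 2"] e by (auto simp: L_def V_def)
    then obtain m where m: "1 \<le> m" "p m / real m < L + e / 2" by (auto simp: V_def)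
    have mult: "p (q * m + r) \<le> real q * p m + p r" for q r
    proof (induction q)
      case (Suc q)
      have "p (Suc q * m + r) \<le> p m + p (q * m + r)" using sub[of m "q * m + r"] by (simp add: ac_simps)
      with Suc show ?case by (simp add: algebra_simps)
    qed simp
    define C where "C = (\<Sum>r<m. \<bar>p r\<bar>) + \<bar>p m\<bar>"
    obtain n0 :: nat where n0: "2 * C / e < real n0" using reals_Archimedean2 by blast
    have "norm (p n / real n - L) < e" if n: "max 1 n0 \<le> n" for n
    proof -
      define q where "q = n div m"
      define r where "r = n mod m"
      have nqr: "n = q * m + r" and r: "r < m" using m by (auto simp: q_def r_def)
      have pr: "p r \<le> (\<Sum>r<m. \<bar>p r\<bar>)"
        using member_le_sum[of r "{..<m}" "\<lambda>r. \<bar>p r\<bar>"] r by simp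
      have "real q * p m = (real q * real m) * (p m / m)" using m(1) by simp
      also have "real q * real m = real n - real r" unfolding nqr by simp
      also have "(real n - real r) * (p m / m) = real n * (p m / m) - (real r / real m) * p m"
        by (simp add: left_diff_distrib diff_divide_distrib)
      also have "\<dots> \<le> real n * (p m / m) + 1 * \<bar>p m\<bar>"
      proof -
        have "\<bar>(real r / real m) * p m\<bar> \<le> 1 * \<bar>p m\<bar>"
          unfolding abs_mult using r m(1) by (intro mult_right_mono) auto
        then show ?thesis by linarith
      qed
      finally have "p n \<le> real n * (p m / m) + C"
        using mult[of q r] pr nqr by (simp add: C_def)
      then have "p n / real n \<le> p m / m + C / real n"
        using n by (simp add: field_simps)
      moreover have "C / real n < e / 2"
      proof -
        have "2 * C / e < real n" using n0 n by linarith
        then show ?thesis using e n by (simp add: field_simps)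
      qed
      ultimately have "p n / real n - L < e" using m(2) by linarith
      then show ?thesis using L_le[of n] n by simp
    qed
    then show "\<exists>no. \<forall>n\<ge>no. norm (p n / real n - L) < e" by blast
  qed
  then show ?thesis by (rule convergentI)
qed

text \<open>
  The mean value inequality on the half-plane \<open>Re z \<le> c\<close>, where the derivative of the exponential is
  bounded by \<open>exp c\<close>.
\<close>

lemma norm_exp_diff_le:
  fixes z w :: complex
  assumes "Re z \<le> c" "Re w \<le> c"
  shows "norm (exp z - exp w) \<le> exp c * norm (z - w)"
  by (rule field_differentiable_bound[of "{z. Re z \<le> c}" exp exp])
    (auto intro!: derivative_eq_intros convex_halfspace_Re_le assms)

section \<open>Shift spaces\<close>

lemma left_shift_pow: "(left_shift ^^ k) x n = x (k + n)"
  by (induction k arbitrary: n) (auto simp: left_shift_def)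

lemma left_shift_pow_mem: "x \<in> shift_space I A \<Longrightarrow> (left_shift ^^ k) x \<in> shift_space I A"
  by (auto simp: shift_space_def left_shift_pow)

lemma left_shift_pow_conc: "length w = n \<Longrightarrow> (left_shift ^^ n) (w \<frown> x) = x"
  by (auto simp: fun_eq_iff left_shift_pow)

lemma conc_left_shift_pow: "map y [0..<n] \<frown> (left_shift ^^ n) y = y"
  by (auto simp: fun_eq_iff left_shift_pow conc_def)

lemma prefix_mem_words: "x \<in> shift_space I A \<Longrightarrow> map x [0..<n] \<in> words I A n"
  unfolding words_def by (rule CollectI, intro exI[of _ x] exI[of _ 0]) simp

lemma mem_cylinder_prefix: "x \<in> shift_space I A \<Longrightarrow> x \<in> cylinder I A (map x [0..<n])"
  by (simp add: cylinder_def)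

lemma words_length: "w \<in> words I A n \<Longrightarrow> length w = n"
  by (auto simp: words_def)

lemma cylinder_nonempty:
  assumes "w \<in> words I A n" obtains x where "x \<in> cylinder I A w"
proof -
  from assms obtain x k where w: "w = map x [k..<k + n]" and x: "x \<in> shift_space I A"
    by (auto simp: words_def)
  have "(left_shift ^^ k) x \<in> cylinder I A w"
    using left_shift_pow_mem[OF x] by (auto simp: cylinder_def w left_shift_pow)
  then show thesis using that by blast
qed

lemma words_split:
  assumes "w \<in> words I A (n + m)"
  shows "take n w \<in> words I A n" "drop n w \<in> words I A m"
proof -
  from assms obtain x k where w: "w = map x [k..<k + (n + m)]" and x: "x \<in> shift_space I A"
    by (auto simp: words_def)
  have "take n w = map x [k..<k + n]" by (auto simp: w take_map)
  moreover have "drop n w = map x [(k + n)..<(k + n) + m]" by (auto simp: w drop_map add.assoc)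
  ultimately show "take n w \<in> words I A n" "drop n w \<in> words I A m"
    using x unfolding words_def by blast+
qed

text \<open>
  Admissibility of \<open>w \<frown> x\<close> constrains \<open>x\<close> only through its first letter. Hence points with the same
  first letter have corresponding preimages under every power of the shift.
\<close>

lemma conc_mem_shift_space:
  assumes y: "w \<frown> x \<in> shift_space I A" and x': "x' \<in> shift_space I A" and eq: "x 0 = x' 0"
  shows "w \<frown> x' \<in> shift_space I A"
proof -
  have "(w \<frown> x') j \<in> I" for j
    using y x' by (cases "j < length w") (auto simp: shift_space_def conc_def split: if_splits)
  moreover have "A ((w \<frown> x') j) ((w \<frown> x') (Suc j))" for j
  proof -
    consider "Suc j < length w" | "Suc j = length w" | "length w \<le> j" by linarith
    then show ?thesis
    proof cases
      case 1
      then have "(w \<frown> x') j = (w \<frown> x) j" "(w \<frown> x') (Suc j) = (w \<frown> x) (Suc j)" by (auto simp: conc_def)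
      then show ?thesis using y by (auto simp: shift_space_def)
    next
      case 2
      then have "(w \<frown> x') j = (w \<frown> x) j" "(w \<frown> x') (Suc j) = (w \<frown> x) (Suc j)"
        using eq by (auto simp: conc_def)
      then show ?thesis using y by (auto simp: shift_space_def)
    next
      case 3
      then show ?thesis using x' by (auto simp: shift_space_def conc_def Suc_diff_le)
    qed
  qed
  ultimately show ?thesis by (simp add: shift_space_def)
qed

section \<open>The Banach space of bounded Hoelder functions\<close>

locale holder_shift =
  fixes I :: "nat set" and A :: "nat \<Rightarrow> nat \<Rightarrow> bool" and \<theta> :: real
  assumes \<theta>_pos: "0 < \<theta>" and \<theta>_less: "\<theta> < 1"
    and nonempty: "shift_space I A \<noteq> {}"
begin

abbreviation E where "E \<equiv> shift_space I A"
abbreviation X where "X \<equiv> bounded_holder_space I A \<theta>"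
abbreviation N where "N \<equiv> bounded_holder_norm I A \<theta>"

definition holder_coeff :: "((nat \<Rightarrow> nat) \<Rightarrow> complex) \<Rightarrow> real" where
  "holder_coeff g = enn2real (holder_seminorm I A \<theta> g)"

definition sup_norm :: "((nat \<Rightarrow> nat) \<Rightarrow> complex) \<Rightarrow> real" where
  "sup_norm g = (SUP x\<in>E. norm (g x))"

lemma N_eq: "N g = holder_coeff g + sup_norm g"
  by (simp add: bounded_holder_norm_def holder_coeff_def sup_norm_def)

lemma holder_coeff_nonneg: "0 \<le> holder_coeff g"
  by (simp add: holder_coeff_def)

lemma holder_bound:
  assumes g: "g \<in> holder_space I A \<theta>" and xy: "x \<in> E" "y \<in> E" and n: "1 \<le> n" and eq: "\<forall>i<n. x i = y i"
  shows "norm (g x - g y) \<le> holder_coeff g * \<theta> ^ n"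
proof -
  have pos: "0 < \<theta> ^ n" using \<theta>_pos by simp
  have "ennreal (norm (g x - g y)) \<le> variation I A n g"
    unfolding variation_def using xy eq by (intro SUP_upper2[of "(x, y)"]) auto
  then have "ennreal (norm (g x - g y)) / ennreal (\<theta> ^ n) \<le> variation I A n g / ennreal (\<theta> ^ n)"
    by (rule divide_right_mono_ennreal)
  also have "\<dots> \<le> holder_seminorm I A \<theta> g"
    unfolding holder_seminorm_def using n by (intro SUP_upper) auto
  also have "\<dots> = ennreal (holder_coeff g)"
    unfolding holder_coeff_def using g by (simp add: holder_space_def ennreal_enn2real_if less_top)
  finally have "norm (g x - g y) / \<theta> ^ n \<le> holder_coeff g"
    using pos holder_coeff_nonneg by (simp add: divide_ennreal)
  then show ?thesis using pos by (simp add: field_simps)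
qed

text \<open>
  Continuity comes for free: nearby points of the product topology share a long prefix.
\<close>

lemma holder_memI:
  assumes C: "0 \<le> C"
    and g: "\<And>n x y. 1 \<le> n \<Longrightarrow> x \<in> E \<Longrightarrow> y \<in> E \<Longrightarrow> \<forall>i<n. x i = y i \<Longrightarrow> norm (g x - g y) \<le> C * \<theta> ^ n"
  shows "g \<in> holder_space I A \<theta>" "holder_coeff g \<le> C"
proof -
  have le: "holder_seminorm I A \<theta> g \<le> ennreal C"
    unfolding holder_seminorm_def
  proof (rule SUP_least)
    fix n :: nat assume n: "n \<in> {1..}"
    have "variation I A n g \<le> ennreal (C * \<theta> ^ n)"
      unfolding variation_def using g n by (intro SUP_least) (auto intro!: ennreal_leI)
    then have "variation I A n g / ennreal (\<theta> ^ n) \<le> ennreal (C * \<theta> ^ n) / ennreal (\<theta> ^ n)"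
      by (rule divide_right_mono_ennreal)
    also have "\<dots> = ennreal C" using C \<theta>_pos by (simp add: divide_ennreal)
    finally show "variation I A n g / ennreal (\<theta> ^ n) \<le> ennreal C" .
  qed
  show "holder_coeff g \<le> C" unfolding holder_coeff_def using enn2real_mono[OF le] C by simp
  have "continuous_on E g"
    unfolding continuous_on_def
  proof (intro ballI tendstoI)
    fix x :: "nat \<Rightarrow> nat" and e :: real assume x: "x \<in> E" and e: "0 < e"
    have "(\<lambda>n. C * \<theta> ^ n) \<longlonglongrightarrow> C * 0"
      using \<theta>_pos \<theta>_less by (intro tendsto_mult_left LIMSEQ_realpow_zero) auto
    then have "\<forall>\<^sub>F n in sequentially. C * \<theta> ^ n < e \<and> 1 \<le> n"
      using e by (intro eventually_conj order_tendstoD(2) eventually_ge_at_top) auto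
    then obtain n where n: "C * \<theta> ^ n < e" "1 \<le> n" by (auto simp: eventually_sequentially)
    have "\<forall>\<^sub>F y in at x within E. y i = x i" for i
    proof -
      have "continuous_on E (\<lambda>y. y i)"
        by (rule continuous_on_subset[OF continuous_on_product_coordinates subset_UNIV])
      then have "((\<lambda>y. y i) \<longlongrightarrow> x i) (at x within E)"
        using x by (simp only: continuous_on_def)
      then show ?thesis by (simp add: tendsto_discrete)
    qed
    then have "\<forall>\<^sub>F y in at x within E. \<forall>i\<in>{..<n}. y i = x i"
      by (intro eventually_ball_finite) auto
    moreover have "\<forall>\<^sub>F y in at x within E. y \<in> E" by (simp add: eventually_at_filter)
    ultimately show "\<forall>\<^sub>F y in at x within E. dist (g y) (g x) < e"
    proof eventually_elim
      case (elim y)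
      then have "norm (g y - g x) \<le> C * \<theta> ^ n" using g[of n y x] n x by auto
      then show ?case using n by (simp add: dist_norm)
    qed
  qed
  then show "g \<in> holder_space I A \<theta>"
    unfolding holder_space_def using le by (auto intro: le_less_trans)
qed

lemma X_memI:
  assumes "\<And>x. x \<notin> E \<Longrightarrow> g x = 0" and S: "\<And>x. x \<in> E \<Longrightarrow> norm (g x) \<le> S" and C: "0 \<le> C"
    and h: "\<And>n x y. 1 \<le> n \<Longrightarrow> x \<in> E \<Longrightarrow> y \<in> E \<Longrightarrow> \<forall>i<n. x i = y i \<Longrightarrow> norm (g x - g y) \<le> C * \<theta> ^ n"
  shows "g \<in> X" "N g \<le> C + S"
proof -
  have hm: "g \<in> holder_space I A \<theta>" by (rule holder_memI[OF C], rule h)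
  have coeff: "holder_coeff g \<le> C" by (rule holder_memI[OF C], rule h)
  have "continuous_on E g" using hm by (simp add: holder_space_def)
  moreover have "bounded (g ` E)" using S by (auto simp: bounded_iff)
  ultimately show "g \<in> X" using hm assms(1) by (auto simp: bounded_holder_space_def bounded_cont_space_def)
  have "sup_norm g \<le> S" unfolding sup_norm_def using S nonempty by (intro cSUP_least) auto
  then show "N g \<le> C + S" using coeff by (simp add: N_eq)
qed

lemma X_outside: "g \<in> X \<Longrightarrow> x \<notin> E \<Longrightarrow> g x = 0"
  by (auto simp: bounded_holder_space_def bounded_cont_space_def)

lemma X_holder: "g \<in> X \<Longrightarrow> g \<in> holder_space I A \<theta>"
  by (auto simp: bounded_holder_space_def)

lemma norm_le_sup_norm_E:
  assumes g: "g \<in> X" and x: "x \<in> E"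
  shows "norm (g x) \<le> sup_norm g"
proof -
  have "bounded (g ` E)" using g by (auto simp: bounded_holder_space_def bounded_cont_space_def)
  then have "bdd_above ((\<lambda>x. norm (g x)) ` E)" by (auto simp: bounded_iff bdd_above_def)
  then show ?thesis unfolding sup_norm_def by (rule cSUP_upper[OF x])
qed

lemma sup_norm_nonneg: "g \<in> X \<Longrightarrow> 0 \<le> sup_norm g"
proof -
  assume g: "g \<in> X"
  obtain x where "x \<in> E" using nonempty by blast
  from order_trans[OF norm_ge_zero norm_le_sup_norm_E[OF g this]] show ?thesis .
qed

lemma norm_le_sup_norm: "g \<in> X \<Longrightarrow> norm (g x) \<le> sup_norm g"
  using norm_le_sup_norm_E[of g x] sup_norm_nonneg[of g] X_outside[of g x] by (cases "x \<in> E") auto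

lemma X_bound: "\<lbrakk>g \<in> X; x \<in> E; y \<in> E; 1 \<le> n; \<forall>i<n. x i = y i\<rbrakk> \<Longrightarrow> norm (g x - g y) \<le> holder_coeff g * \<theta> ^ n"
  using holder_bound[OF X_holder] .

lemma X_scale:
  assumes g: "g \<in> X"
  shows "(\<lambda>x. c * g x) \<in> X" "N (\<lambda>x. c * g x) \<le> norm c * N g"
proof -
  have h: "norm (c * g x - c * g y) \<le> (norm c * holder_coeff g) * \<theta> ^ n"
    if "1 \<le> n" "x \<in> E" "y \<in> E" "\<forall>i<n. x i = y i" for n x y
  proof -
    have "norm (c * g x - c * g y) = norm c * norm (g x - g y)"
      unfolding right_diff_distrib[symmetric] norm_mult ..
    also have "\<dots> \<le> norm c * (holder_coeff g * \<theta> ^ n)" by (intro mult_left_mono X_bound g that) auto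
    finally show ?thesis by (simp add: mult.assoc)
  qed
  have out: "c * g x = 0" if "x \<notin> E" for x using X_outside[OF g that] by simp
  have b: "norm (c * g x) \<le> norm c * sup_norm g" for x
    unfolding norm_mult by (intro mult_left_mono norm_le_sup_norm g norm_ge_zero)
  have C: "0 \<le> norm c * holder_coeff g" by (simp add: holder_coeff_nonneg)
  show "(\<lambda>x. c * g x) \<in> X"
    by (rule X_memI[where C = "norm c * holder_coeff g" and S = "norm c * sup_norm g"], rule out, assumption, rule b, rule C, rule h)
  have "N (\<lambda>x. c * g x) \<le> norm c * holder_coeff g + norm c * sup_norm g"
    by (rule X_memI[where C = "norm c * holder_coeff g" and S = "norm c * sup_norm g"], rule out, assumption, rule b, rule C, rule h)
  then show "N (\<lambda>x. c * g x) \<le> norm c * N g" by (simp add: N_eq algebra_simps)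
qed

lemma X_add:
  assumes g: "g \<in> X" and h: "h \<in> X"
  shows "(\<lambda>x. g x + h x) \<in> X" "N (\<lambda>x. g x + h x) \<le> N g + N h"
proof -
  have hld: "norm (g x + h x - (g y + h y)) \<le> (holder_coeff g + holder_coeff h) * \<theta> ^ n"
    if "1 \<le> n" "x \<in> E" "y \<in> E" "\<forall>i<n. x i = y i" for n x y
  proof -
    have "norm (g x + h x - (g y + h y)) \<le> norm (g x - g y) + norm (h x - h y)"
      by (rule norm_diff_triangle_ineq)
    also have "\<dots> \<le> holder_coeff g * \<theta> ^ n + holder_coeff h * \<theta> ^ n" by (intro add_mono X_bound g h that)
    finally show ?thesis by (simp add: algebra_simps)
  qed
  have out: "g x + h x = 0" if "x \<notin> E" for x using X_outside[OF g that] X_outside[OF h that] by simp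
  have C: "0 \<le> holder_coeff g + holder_coeff h" by (simp add: holder_coeff_nonneg)
  have b: "norm (g x + h x) \<le> sup_norm g + sup_norm h" for x
    using norm_le_sup_norm[OF g, of x] norm_le_sup_norm[OF h, of x] norm_triangle_ineq[of "g x" "h x"] by linarith
  show "(\<lambda>x. g x + h x) \<in> X"
    by (rule X_memI[where C = "holder_coeff g + holder_coeff h" and S = "sup_norm g + sup_norm h"], rule out, assumption, rule b, rule C, rule hld)
  have "N (\<lambda>x. g x + h x) \<le> (holder_coeff g + holder_coeff h) + (sup_norm g + sup_norm h)"
    by (rule X_memI[where C = "holder_coeff g + holder_coeff h" and S = "sup_norm g + sup_norm h"], rule out, assumption, rule b, rule C, rule hld)
  then show "N (\<lambda>x. g x + h x) \<le> N g + N h" by (simp add: N_eq algebra_simps)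
qed

text \<open>
  The two parts of the norm must be bounded jointly, since only their sum is at most \<open>C\<close>. So the limit
  is taken in the sum of one difference quotient and one value, and the suprema are formed afterwards.
\<close>

lemma X_fatou:
  assumes G: "\<And>k::nat. G k \<in> X" and C: "\<And>k. N (G k) \<le> C" and lim: "\<And>x. (\<lambda>k. G k x) \<longlonglongrightarrow> g x"
  shows "g \<in> X" "N g \<le> C"
proof -
  have main: "norm (g x - g y) / \<theta> ^ n + norm (g z) \<le> C"
    if "1 \<le> n" "x \<in> E" "y \<in> E" "\<forall>i<n. x i = y i" for n x y z
  proof (rule LIMSEQ_le_const2)
    show "(\<lambda>k. norm (G k x - G k y) / \<theta> ^ n + norm (G k z)) \<longlonglongrightarrow> norm (g x - g y) / \<theta> ^ n + norm (g z)"
      using \<theta>_pos by (intro tendsto_add tendsto_divide tendsto_norm tendsto_diff tendsto_const lim) simp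
    have "norm (G k x - G k y) / \<theta> ^ n + norm (G k z) \<le> C" for k
    proof -
      have "norm (G k x - G k y) / \<theta> ^ n \<le> holder_coeff (G k)"
        using X_bound[OF G that(2,3,1,4), of k] \<theta>_pos by (simp add: field_simps)
      then show ?thesis using norm_le_sup_norm[OF G, of k z] C[of k] by (simp add: N_eq)
    qed
    then show "\<exists>M. \<forall>k\<ge>M. norm (G k x - G k y) / \<theta> ^ n + norm (G k z) \<le> C" by blast
  qed
  have out: "g x = 0" if "x \<notin> E" for x
    using lim[of x] X_outside[OF G that] by (simp add: LIMSEQ_const_iff)
  obtain z0 where z0: "z0 \<in> E" using nonempty by blast
  have gz: "norm (g z) \<le> C" for z
    using main[of 1 z0 z0 z] z0 by simp
  have hC: "norm (g x - g y) \<le> (C - norm (g z)) * \<theta> ^ n"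
    if "1 \<le> n" "x \<in> E" "y \<in> E" "\<forall>i<n. x i = y i" for n x y z
    using main[OF that, of z] \<theta>_pos by (simp add: field_simps)
  show "g \<in> X"
    by (rule X_memI[where C = "C - norm (g z0)" and S = C], rule out, assumption, rule gz,
        use gz in simp, rule hC)
  have "holder_coeff g \<le> C - norm (g z)" for z
    by (rule holder_memI(2), use gz in simp, rule hC)
  then have "norm (g z) \<le> C - holder_coeff g" for z by (simp add: algebra_simps)
  then have "sup_norm g \<le> C - holder_coeff g" unfolding sup_norm_def using nonempty by (intro cSUP_least) auto
  then show "N g \<le> C" by (simp add: N_eq)
qed

sublocale normed_function_space X N
proof
  have z: "(\<lambda>x. 0) \<in> X" "N (\<lambda>x. 0) \<le> 0 + 0"
    by (rule X_memI[where S = 0 and C = 0]; simp)+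
  then show "(\<lambda>x. 0) \<in> X" by simp
  fix g h :: "(nat \<Rightarrow> nat) \<Rightarrow> complex" and c :: complex assume g: "g \<in> X"
  show "(\<lambda>x. c * g x) \<in> X" by (rule X_scale[OF g])
  show "N (\<lambda>x. c * g x) = norm c * N g"
  proof (cases "c = 0")
    case True
    then show ?thesis using z holder_coeff_nonneg[of "\<lambda>x. 0"] sup_norm_nonneg[OF z(1)] by (simp add: N_eq)
  next
    case False
    have "N (\<lambda>x. inverse c * (c * g x)) \<le> norm (inverse c) * N (\<lambda>x. c * g x)"
      by (intro X_scale g)
    then have "norm c * N g \<le> N (\<lambda>x. c * g x)"
      using False by (simp add: norm_inverse norm_divide field_simps)
    then show ?thesis using X_scale(2)[OF g, of c] by linarith
  qed
  show "norm (g x) \<le> N g" for x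
    using norm_le_sup_norm[OF g, of x] holder_coeff_nonneg[of g] by (simp add: N_eq)
  assume h: "h \<in> X"
  show "(\<lambda>x. g x + h x) \<in> X" "N (\<lambda>x. g x + h x) \<le> N g + N h" using X_add[OF g h] by auto
next
  fix G :: "nat \<Rightarrow> (nat \<Rightarrow> nat) \<Rightarrow> complex" and C g
  assume "\<And>k. G k \<in> X" "\<And>k. N (G k) \<le> C" "\<And>x. (\<lambda>k. G k x) \<longlonglongrightarrow> g x"
  then show "g \<in> X \<and> N g \<le> C" using X_fatou by blast
qed

end

section \<open>Birkhoff sums and weights of words\<close>

lemma left_shift_pow_add: "(left_shift ^^ (n + m)) y = (left_shift ^^ m) ((left_shift ^^ n) y)"
  by (auto simp: fun_eq_iff left_shift_pow add.assoc)

locale holder_potential = holder_shift +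
  fixes f :: "(nat \<Rightarrow> nat) \<Rightarrow> complex"
  assumes f_holder: "f \<in> holder_space I A \<theta>"
    and f_summable: "summable_potential I A (\<lambda>x. Re (f x))"
begin

abbreviation u where "u \<equiv> \<lambda>x. Re (f x)"
abbreviation T where "T \<equiv> transfer_op I A f"

definition complex_birkhoff_sum :: "nat \<Rightarrow> (nat \<Rightarrow> nat) \<Rightarrow> complex" where
  "complex_birkhoff_sum n y = (\<Sum>j<n. f ((left_shift ^^ j) y))"

definition distortion :: real where "distortion = holder_coeff f / (1 - \<theta>)"

definition weight :: "nat list \<Rightarrow> real" where
  "weight w = exp (SUP \<tau>\<in>cylinder I A w. birkhoff_sum (length w) u \<tau>)"

text \<open>
  The partition function; its exponential growth rate is the pressure of \<open>u\<close>.
\<close>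

definition partition_sum :: "nat \<Rightarrow> real" where "partition_sum n = (\<Sum>\<^sub>\<infinity>w\<in>words I A n. weight w)"

definition preimages :: "nat \<Rightarrow> (nat \<Rightarrow> nat) \<Rightarrow> (nat \<Rightarrow> nat) set" where
  "preimages n x = {y \<in> E. (left_shift ^^ n) y = x}"

text \<open>
  This turns out to be the \<open>n\<close>-th power of the transfer operator. It is a separate constant because the
  estimates for it are what shows that the transfer operator maps the Hoelder space to itself.
\<close>

definition iter_op :: "nat \<Rightarrow> ((nat \<Rightarrow> nat) \<Rightarrow> complex) \<Rightarrow> (nat \<Rightarrow> nat) \<Rightarrow> complex" where
  "iter_op n g x = (\<Sum>\<^sub>\<infinity>y\<in>preimages n x. exp (complex_birkhoff_sum n y) * g y)"

lemma Re_complex_birkhoff_sum: "Re (complex_birkhoff_sum n y) = birkhoff_sum n u y"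
  by (simp add: complex_birkhoff_sum_def birkhoff_sum_def)

lemma complex_birkhoff_sum_add: "complex_birkhoff_sum (n + m) y = complex_birkhoff_sum n y + complex_birkhoff_sum m ((left_shift ^^ n) y)"
  by (induction m) (auto simp: complex_birkhoff_sum_def left_shift_pow_add add.assoc[symmetric])

lemma birkhoff_add: "birkhoff_sum (n + m) u y = birkhoff_sum n u y + birkhoff_sum m u ((left_shift ^^ n) y)"
  by (simp add: Re_complex_birkhoff_sum[symmetric] complex_birkhoff_sum_add)

lemma distortion_nonneg: "0 \<le> distortion"
  using \<theta>_less holder_coeff_nonneg by (simp add: distortion_def)

text \<open>
  After \<open>j\<close> shifts the points still agree on \<open>n + m - j\<close> letters, so the summands are bounded by a
  geometric series whose largest term is of order \<open>\<theta> ^ m\<close>.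
\<close>

lemma bounded_distortion:
  assumes x: "x \<in> E" and y: "y \<in> E" and eq: "\<forall>i<n + m. x i = y i"
  shows "norm (complex_birkhoff_sum n x - complex_birkhoff_sum n y) \<le> distortion * \<theta> ^ m"
proof -
  have "norm (complex_birkhoff_sum n x - complex_birkhoff_sum n y) \<le> (\<Sum>j<n. norm (f ((left_shift ^^ j) x) - f ((left_shift ^^ j) y)))"
    unfolding complex_birkhoff_sum_def sum_subtractf[symmetric] by (rule norm_sum)
  also have "\<dots> \<le> (\<Sum>j<n. holder_coeff f * \<theta> ^ m * \<theta> ^ (n - Suc j))"
  proof (rule sum_mono)
    fix j assume j: "j \<in> {..<n}"
    have "norm (f ((left_shift ^^ j) x) - f ((left_shift ^^ j) y)) \<le> holder_coeff f * \<theta> ^ (n + m - j)"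
      using j eq by (intro holder_bound f_holder left_shift_pow_mem x y) (auto simp: left_shift_pow)
    also have "\<dots> \<le> holder_coeff f * \<theta> ^ (m + (n - Suc j))"
      using j \<theta>_pos \<theta>_less holder_coeff_nonneg by (intro mult_left_mono power_decreasing) auto
    finally show "norm (f ((left_shift ^^ j) x) - f ((left_shift ^^ j) y)) \<le> holder_coeff f * \<theta> ^ m * \<theta> ^ (n - Suc j)"
      by (simp add: power_add mult.assoc)
  qed
  also have "\<dots> = holder_coeff f * \<theta> ^ m * (\<Sum>j<n. \<theta> ^ j)"
    unfolding sum_distrib_left[symmetric] sum.nat_diff_reindex ..
  also have "(\<Sum>j<n. \<theta> ^ j) \<le> 1 / (1 - \<theta>)"
    using \<theta>_pos \<theta>_less by (simp add: sum_gp_strict divide_right_mono)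
  then have "holder_coeff f * \<theta> ^ m * (\<Sum>j<n. \<theta> ^ j) \<le> holder_coeff f * \<theta> ^ m * (1 / (1 - \<theta>))"
    using \<theta>_pos holder_coeff_nonneg by (intro mult_left_mono) auto
  finally show ?thesis by (simp add: distortion_def field_simps)
qed

text \<open>
  The potential itself may be unbounded; on a cylinder, distortion compares all values with the one at a
  single point.
\<close>

lemma birkhoff_bdd_above:
  assumes w: "w \<in> words I A n"
  shows "bdd_above (birkhoff_sum n u ` cylinder I A w)"
proof -
  obtain x where x: "x \<in> cylinder I A w" using cylinder_nonempty[OF w] .
  have "birkhoff_sum n u y \<le> birkhoff_sum n u x + distortion" if y: "y \<in> cylinder I A w" for y
  proof -
    have "norm (complex_birkhoff_sum n y - complex_birkhoff_sum n x) \<le> distortion * \<theta> ^ 0"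
      using x y words_length[OF w] by (intro bounded_distortion) (auto simp: cylinder_def)
    then have "\<bar>Re (complex_birkhoff_sum n y - complex_birkhoff_sum n x)\<bar> \<le> distortion"
      using abs_Re_le_cmod[of "complex_birkhoff_sum n y - complex_birkhoff_sum n x"] by simp
    then show ?thesis by (simp add: Re_complex_birkhoff_sum)
  qed
  then show ?thesis by (auto intro!: bdd_aboveI2)
qed

lemma birkhoff_le_ln_weight:
  assumes w: "w \<in> words I A n" and y: "y \<in> cylinder I A w"
  shows "birkhoff_sum n u y \<le> ln (weight w)"
  unfolding weight_def words_length[OF w] ln_exp by (rule cSUP_upper[OF y birkhoff_bdd_above[OF w]])

lemma weight_pos: "0 < weight w"
  by (simp add: weight_def)

lemma weight_split:
  assumes w: "w \<in> words I A (n + m)"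
  shows "weight w \<le> weight (take n w) * weight (drop n w)"
proof -
  have "(SUP \<tau>\<in>cylinder I A w. birkhoff_sum (length w) u \<tau>) \<le> ln (weight (take n w)) + ln (weight (drop n w))"
  proof (rule cSUP_least)
    show "cylinder I A w \<noteq> {}" using cylinder_nonempty[OF w] by blast
    fix y assume y: "y \<in> cylinder I A w"
    have "y \<in> cylinder I A (take n w)" using y by (auto simp: cylinder_def)
    moreover have "(left_shift ^^ n) y \<in> cylinder I A (drop n w)"
      using y left_shift_pow_mem[of y I A n] words_length[OF w] by (auto simp: cylinder_def left_shift_pow)
    ultimately show "birkhoff_sum (length w) u y \<le> ln (weight (take n w)) + ln (weight (drop n w))"
      unfolding words_length[OF w] birkhoff_add
      by (intro add_mono birkhoff_le_ln_weight words_split[OF w])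
  qed
  then have "weight w \<le> exp (ln (weight (take n w)) + ln (weight (drop n w)))"
    unfolding weight_def[of w] by simp
  then show ?thesis by (simp add: exp_add weight_pos)
qed

text \<open>
  Cutting a word after \<open>n\<close> letters maps the words of length \<open>n + m\<close> injectively into pairs of words, and
  the weight is submultiplicative under this cut.
\<close>

lemma summable_weight_add:
  assumes n: "weight summable_on words I A n" and m: "weight summable_on words I A m"
  shows "weight summable_on words I A (n + m)" "partition_sum (n + m) \<le> partition_sum n * partition_sum m"
proof -
  let ?P = "words I A n \<times> words I A m" and ?G = "\<lambda>p. weight (fst p) * weight (snd p)"
    and ?\<phi> = "\<lambda>w. (take n w, drop n w)"
  have G: "?G summable_on ?P"
    by (rule summable_on_SigmaI[where g = "\<lambda>v. weight v * partition_sum m"])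
      (auto simp: partition_sum_def less_imp_le[OF weight_pos] intro!: has_sum_cmult_right has_sum_infsum m
         summable_on_cmult_left n)
  have "(?G has_sum (partition_sum n * partition_sum m)) ?P"
    by (rule has_sum_SigmaI[where g = "\<lambda>v. weight v * partition_sum m"])
      (auto simp: partition_sum_def intro!: has_sum_cmult_right has_sum_cmult_left has_sum_infsum m n G)
  then have sumG: "infsum ?G ?P = partition_sum n * partition_sum m" by (rule infsumI)
  have inj: "inj_on ?\<phi> (words I A (n + m))"
    by (auto intro!: inj_onI) (metis append_take_drop_id)
  have sub: "?\<phi> ` words I A (n + m) \<subseteq> ?P" using words_split by auto
  have G': "?G summable_on ?\<phi> ` words I A (n + m)" by (rule summable_on_subset_banach[OF G sub])
  then have G\<phi>: "(?G \<circ> ?\<phi>) summable_on words I A (n + m)" using summable_on_reindex[OF inj] by blast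
  show s: "weight summable_on words I A (n + m)"
    by (rule summable_on_comparison_test[OF G\<phi>]) (auto simp: weight_split less_imp_le[OF weight_pos])
  have "partition_sum (n + m) \<le> infsum (?G \<circ> ?\<phi>) (words I A (n + m))"
    unfolding partition_sum_def by (rule infsum_mono[OF s G\<phi>]) (auto simp: weight_split)
  also have "\<dots> = infsum ?G (?\<phi> ` words I A (n + m))" by (rule infsum_reindex[OF inj, symmetric])
  also have "\<dots> \<le> infsum ?G ?P"
    by (rule infsum_mono2[OF G' G sub]) (simp add: less_imp_le[OF weight_pos])
  finally show "partition_sum (n + m) \<le> partition_sum n * partition_sum m" unfolding sumG .
qed

lemma summable_weight: "weight summable_on words I A n"
proof (induction n)
  case 0
  have "words I A 0 \<subseteq> {[]}" by (auto simp: words_def)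
  then show ?case by (intro summable_on_finite) (rule finite_subset, auto)
next
  case (Suc n)
  have 1: "weight summable_on words I A 1"
  proof -
    have "(weight \<circ> (\<lambda>e. [e])) summable_on I"
      using f_summable by (simp add: summable_potential_def weight_def o_def birkhoff_sum_def)
    then have "weight summable_on (\<lambda>e. [e]) ` I" by (subst summable_on_reindex) (auto simp: inj_on_def)
    moreover have "words I A 1 \<subseteq> (\<lambda>e. [e]) ` I" by (auto simp: words_def shift_space_def)
    ultimately show ?thesis by (rule summable_on_subset_banach)
  qed
  show ?case using summable_weight_add(1)[OF 1 Suc.IH] by simp
qed

lemma partition_sum_add_le: "partition_sum (n + m) \<le> partition_sum n * partition_sum m"
  by (intro summable_weight_add summable_weight)

lemma weight_le_partition_sum: "w \<in> words I A n \<Longrightarrow> weight w \<le> partition_sum n"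
  using finite_sum_le_infsum[OF summable_weight, of "{w}" n] by (simp add: partition_sum_def less_imp_le[OF weight_pos])

lemma partition_sum_pos: "0 < partition_sum n"
proof -
  obtain x where "x \<in> E" using nonempty by blast
  from weight_le_partition_sum[OF prefix_mem_words[OF this], of n] show ?thesis using weight_pos less_le_trans by blast
qed

section \<open>Iterates of the transfer operator\<close>

lemma preimages_conc: "y \<in> preimages n x \<Longrightarrow> map y [0..<n] \<frown> x = y"
  using conc_left_shift_pow[of y n] by (auto simp: preimages_def)

text \<open>
  A preimage of \<open>x\<close> is determined by its prefix, so a sum over preimages is dominated, uniformly in \<open>x\<close>,
  by a sum over words.
\<close>

lemma infsum_preimages:
  fixes F :: "(nat \<Rightarrow> nat) \<Rightarrow> complex"
  assumes b: "b summable_on words I A n" "\<And>w. w \<in> words I A n \<Longrightarrow> 0 \<le> b w"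
    and F: "\<And>y. y \<in> preimages n x \<Longrightarrow> norm (F y) \<le> b (map y [0..<n])"
  shows "(\<lambda>y. norm (F y)) summable_on preimages n x" "norm (infsum F (preimages n x)) \<le> infsum b (words I A n)"
proof -
  let ?p = "\<lambda>y. map y [0..<n]"
  have inj: "inj_on ?p (preimages n x)"
  proof (rule inj_onI)
    fix y z assume "y \<in> preimages n x" "z \<in> preimages n x" "?p y = ?p z"
    then show "y = z" by (metis preimages_conc)
  qed
  have sub: "?p ` preimages n x \<subseteq> words I A n" by (auto simp: preimages_def intro: prefix_mem_words)
  have b': "b summable_on ?p ` preimages n x" by (rule summable_on_subset_banach[OF b(1) sub])
  then have bp: "(b \<circ> ?p) summable_on preimages n x" using summable_on_reindex[OF inj] by blast
  show s: "(\<lambda>y. norm (F y)) summable_on preimages n x"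
    by (rule Infinite_Sum.abs_summable_on_comparison_test'[OF bp]) (simp add: F)
  have "norm (infsum F (preimages n x)) \<le> (\<Sum>\<^sub>\<infinity>y\<in>preimages n x. norm (F y))"
    by (rule norm_infsum_bound[OF s])
  also have "\<dots> \<le> infsum (b \<circ> ?p) (preimages n x)" by (rule infsum_mono[OF s bp]) (simp add: F)
  also have "\<dots> = infsum b (?p ` preimages n x)" by (rule infsum_reindex[OF inj, symmetric])
  also have "\<dots> \<le> infsum b (words I A n)" by (rule infsum_mono2[OF b' b(1) sub]) (use b(2) in auto)
  finally show "norm (infsum F (preimages n x)) \<le> infsum b (words I A n)" .
qed

lemma norm_exp_complex_birkhoff_sum_le:
  assumes "y \<in> preimages n x" shows "norm (exp (complex_birkhoff_sum n y)) \<le> weight (map y [0..<n])"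
proof -
  have y: "y \<in> E" using assms by (simp add: preimages_def)
  have "birkhoff_sum n u y \<le> ln (weight (map y [0..<n]))"
    by (rule birkhoff_le_ln_weight[OF prefix_mem_words[OF y] mem_cylinder_prefix[OF y]])
  then have "exp (birkhoff_sum n u y) \<le> exp (ln (weight (map y [0..<n])))" by simp
  then show ?thesis by (simp add: norm_exp_eq_Re Re_complex_birkhoff_sum weight_pos)
qed

lemma iter_op_sum:
  assumes g: "g \<in> X"
  shows "(\<lambda>y. norm (exp (complex_birkhoff_sum n y) * g y)) summable_on preimages n x" "norm (iter_op n g x) \<le> partition_sum n * sup_norm g"
proof -
  have F: "norm (exp (complex_birkhoff_sum n y) * g y) \<le> weight (map y [0..<n]) * sup_norm g" if "y \<in> preimages n x" for y
    unfolding norm_mult by (intro mult_mono norm_exp_complex_birkhoff_sum_le[OF that] norm_le_sup_norm g less_imp_le[OF weight_pos]) simp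
  have b: "(\<lambda>w. weight w * sup_norm g) summable_on words I A n" by (intro summable_on_cmult_left summable_weight)
  have b0: "0 \<le> weight w * sup_norm g" for w using weight_pos[of w] sup_norm_nonneg[OF g] by simp
  show "(\<lambda>y. norm (exp (complex_birkhoff_sum n y) * g y)) summable_on preimages n x"
    by (rule infsum_preimages(1)[OF b b0 F])
  show "norm (iter_op n g x) \<le> partition_sum n * sup_norm g"
    using infsum_preimages(2)[OF b b0 F] unfolding iter_op_def partition_sum_def by (simp add: infsum_cmult_left')
qed

lemmas iter_op_summable = abs_summable_summable[OF iter_op_sum(1)]

definition sample_point :: "nat list \<Rightarrow> nat \<Rightarrow> nat" where "sample_point w = (SOME x. x \<in> cylinder I A w)"

lemma sample_point_mem: "w \<in> words I A n \<Longrightarrow> sample_point w \<in> cylinder I A w"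
  using cylinder_nonempty[of w I A n] someI[of "\<lambda>x. x \<in> cylinder I A w"] unfolding sample_point_def by blast

text \<open>
  A bound, independent of the base point, for the contribution to \<open>iter_op n g\<close> of the preimage with
  prefix \<open>w\<close>. That \<open>g\<close> enters mainly through its values at countably many fixed points is the source of
  the compactness.
\<close>

definition majorant :: "nat \<Rightarrow> ((nat \<Rightarrow> nat) \<Rightarrow> complex) \<Rightarrow> nat list \<Rightarrow> real" where
  "majorant n g w = weight w * (norm (g (sample_point w)) + \<theta> ^ n * holder_coeff g)"

lemma majorant_nonneg: "0 \<le> majorant n g w"
  using weight_pos[of w] \<theta>_pos holder_coeff_nonneg[of g] by (simp add: majorant_def)

lemma majorant_le:
  assumes g: "g \<in> X" shows "majorant n g w \<le> weight w * N g"
proof -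
  have "\<theta> ^ n * holder_coeff g \<le> 1 * holder_coeff g"
    using \<theta>_pos \<theta>_less holder_coeff_nonneg by (intro mult_right_mono power_le_one) auto
  then show ?thesis unfolding majorant_def N_eq
    using norm_le_sup_norm[OF g, of "sample_point w"] weight_pos[of w] by (intro mult_left_mono) auto
qed

lemma majorant_summable: 
  assumes g: "g \<in> X" shows "majorant n g summable_on words I A n"
  by (rule summable_on_comparison_test[OF summable_on_cmult_left[OF summable_weight, of "N g"]])
    (auto simp: majorant_le g majorant_nonneg)

lemma norm_le_sample_point:
  assumes g: "g \<in> X" and n: "1 \<le> n" and y: "y \<in> E"
  shows "norm (g y) \<le> norm (g (sample_point (map y [0..<n]))) + \<theta> ^ n * holder_coeff g"
proof -
  have r: "sample_point (map y [0..<n]) \<in> cylinder I A (map y [0..<n])" by (rule sample_point_mem[OF prefix_mem_words[OF y]])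
  then have "norm (g y - g (sample_point (map y [0..<n]))) \<le> holder_coeff g * \<theta> ^ n"
    by (intro X_bound g y n) (auto simp: cylinder_def)
  then show ?thesis using norm_triangle_ineq2[of "g y" "g (sample_point (map y [0..<n]))"] by (simp add: mult.commute)
qed

lemma iter_op_le_majorant:
  assumes g: "g \<in> X" and n: "1 \<le> n"
  shows "norm (iter_op n g x) \<le> infsum (majorant n g) (words I A n)"
  unfolding iter_op_def
proof (rule infsum_preimages(2)[OF majorant_summable[OF g] majorant_nonneg])
  fix y assume y: "y \<in> preimages n x"
  then show "norm (exp (complex_birkhoff_sum n y) * g y) \<le> majorant n g (map y [0..<n])"
    unfolding norm_mult majorant_def
    by (intro mult_mono norm_exp_complex_birkhoff_sum_le norm_le_sample_point g n less_imp_le[OF weight_pos])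
      (auto simp: preimages_def)
qed

text \<open>
  Two points with a common prefix of length \<open>m \<ge> 1\<close> have the same admissible words in front of them.
  Exchanging the tails pairs their preimages so that partners agree on \<open>n + m\<close> letters. In each pair
  the change of \<open>g\<close> is controlled by its Hoelder constant and the change of the exponential factor
  by bounded distortion.
\<close>

lemma iter_op_variation:
  assumes g: "g \<in> X" and n: "1 \<le> n" and m: "1 \<le> m"
    and x: "x \<in> E" and x': "x' \<in> E" and eq: "\<forall>i<m. x i = x' i"
  shows "norm (iter_op n g x - iter_op n g x')
       \<le> (1 + distortion) * infsum (majorant n g) (words I A n) * \<theta> ^ m"
proof -
  define \<psi> where "\<psi> = (\<lambda>y. map y [0..<n] \<frown> x')"
  have \<psi>: "\<psi> y \<in> preimages n x'" "\<forall>i<n + m. y i = \<psi> y i" "map (\<psi> y) [0..<n] = map y [0..<n]"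
    if y: "y \<in> preimages n x" for y
  proof -
    note c = preimages_conc[OF y]
    have "y \<in> E" using y by (simp add: preimages_def)
    then have "map y [0..<n] \<frown> x \<in> E" by (simp only: c)
    then have "\<psi> y \<in> E"
      unfolding \<psi>_def by (rule conc_mem_shift_space[OF _ x']) (use eq m in simp)
    then show "\<psi> y \<in> preimages n x'"
      by (simp add: preimages_def) (simp add: \<psi>_def left_shift_pow_conc)
    show "\<forall>i<n + m. y i = \<psi> y i"
    proof (intro allI impI)
      fix i assume i: "i < n + m"
      show "y i = \<psi> y i"
      proof (cases "i < n")
        case True
        then show ?thesis by (simp add: \<psi>_def)
      next
        case False
        have "x (i - n) = y i" using y False by (auto simp: preimages_def left_shift_pow)
        moreover have "\<psi> y i = x' (i - n)" using False by (simp add: \<psi>_def)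
        moreover have "x (i - n) = x' (i - n)" using eq i False by simp
        ultimately show ?thesis by simp
      qed
    qed
    show "map (\<psi> y) [0..<n] = map y [0..<n]" by (auto simp: \<psi>_def)
  qed
  have bij: "bij_betw \<psi> (preimages n x) (preimages n x')"
  proof (rule bij_betwI[where g = "\<lambda>y. map y [0..<n] \<frown> x"])
    show "\<psi> \<in> preimages n x \<rightarrow> preimages n x'" using \<psi> by auto
    show "(\<lambda>y. map y [0..<n] \<frown> x) \<in> preimages n x' \<rightarrow> preimages n x"
    proof
      fix y assume y: "y \<in> preimages n x'"
      then have "y \<in> E" by (simp add: preimages_def)
      then have "map y [0..<n] \<frown> x' \<in> E" by (simp only: preimages_conc[OF y])
      then have "map y [0..<n] \<frown> x \<in> E"
        by (rule conc_mem_shift_space[OF _ x]) (use eq m in simp)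
      then show "map y [0..<n] \<frown> x \<in> preimages n x"
        by (simp add: preimages_def left_shift_pow_conc)
    qed
    show "map (\<psi> y) [0..<n] \<frown> x = y" if "y \<in> preimages n x" for y
      unfolding \<psi>(3)[OF that] by (rule preimages_conc[OF that])
    show "\<psi> (map y [0..<n] \<frown> x) = y" if "y \<in> preimages n x'" for y
    proof -
      have "map (map y [0..<n] \<frown> x) [0..<n] = map y [0..<n]" by auto
      then show ?thesis unfolding \<psi>_def using preimages_conc[OF that] by (simp only:)
    qed
  qed
  let ?F = "\<lambda>y. exp (complex_birkhoff_sum n y) * g y"
  have x'_eq: "iter_op n g x' = (\<Sum>\<^sub>\<infinity>y\<in>preimages n x. ?F (\<psi> y))"
    unfolding iter_op_def by (rule infsum_reindex_bij_betw[OF bij, symmetric])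
  have "(\<lambda>y. ?F (\<psi> y)) summable_on preimages n x"
    using summable_on_reindex_bij_betw[OF bij, of ?F] iter_op_summable[OF g] by blast
  then have "((\<lambda>y. ?F y + - ?F (\<psi> y)) has_sum (iter_op n g x + - iter_op n g x')) (preimages n x)"
    unfolding x'_eq iter_op_def[of n g x]
    by (intro has_sum_add has_sum_uminusI has_sum_infsum iter_op_summable g)
  then have "norm (iter_op n g x - iter_op n g x') = norm (\<Sum>\<^sub>\<infinity>y\<in>preimages n x. ?F y + - ?F (\<psi> y))"
    unfolding diff_conv_add_uminus by (simp only: infsumI)
  also have "\<dots> \<le> (\<Sum>\<^sub>\<infinity>w\<in>words I A n. ((1 + distortion) * \<theta> ^ m) * majorant n g w)"
  proof (rule infsum_preimages(2))
    show "(\<lambda>w. ((1 + distortion) * \<theta> ^ m) * majorant n g w) summable_on words I A n"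
      by (intro summable_on_cmult_right majorant_summable g)
    show "0 \<le> ((1 + distortion) * \<theta> ^ m) * majorant n g w" for w
      using distortion_nonneg \<theta>_pos majorant_nonneg[of n g w] by simp
    fix y assume y: "y \<in> preimages n x"
    let ?w = "map y [0..<n]"
    define R where "R = norm (g (sample_point ?w)) + \<theta> ^ n * holder_coeff g"
    have yE: "y \<in> E" "\<psi> y \<in> E" using y \<psi>(1)[OF y] by (auto simp: preimages_def)
    have W: "?w \<in> words I A n" by (rule prefix_mem_words[OF yE(1)])
    have cyl: "y \<in> cylinder I A ?w" "\<psi> y \<in> cylinder I A ?w"
      using mem_cylinder_prefix[OF yE(1), of n] mem_cylinder_prefix[OF yE(2), of n] \<psi>(3)[OF y] by simp_all
    \<comment> \<open>Change the factors of the product one at a time.\<close>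
    have "norm (?F y + - ?F (\<psi> y)) = norm (exp (complex_birkhoff_sum n y) * (g y - g (\<psi> y)) + (exp (complex_birkhoff_sum n y) - exp (complex_birkhoff_sum n (\<psi> y))) * g (\<psi> y))"
      by (simp add: algebra_simps)
    also have "\<dots> \<le> norm (exp (complex_birkhoff_sum n y)) * norm (g y - g (\<psi> y))
        + norm (exp (complex_birkhoff_sum n y) - exp (complex_birkhoff_sum n (\<psi> y))) * norm (g (\<psi> y))"
      unfolding norm_mult[symmetric] by (rule norm_triangle_ineq)
    also have "\<dots> \<le> weight ?w * (\<theta> ^ m * R) + (weight ?w * (distortion * \<theta> ^ m)) * R"
    proof (intro add_mono mult_mono norm_exp_complex_birkhoff_sum_le[OF y])
      have "norm (g y - g (\<psi> y)) \<le> holder_coeff g * \<theta> ^ (n + m)"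
        using n \<psi>(2)[OF y] by (intro X_bound g yE) auto
      also have "\<dots> \<le> \<theta> ^ m * R"
        using \<theta>_pos by (simp add: R_def power_add algebra_simps)
      finally show "norm (g y - g (\<psi> y)) \<le> \<theta> ^ m * R" .
      have "norm (exp (complex_birkhoff_sum n y) - exp (complex_birkhoff_sum n (\<psi> y))) \<le> exp (ln (weight ?w)) * norm (complex_birkhoff_sum n y - complex_birkhoff_sum n (\<psi> y))"
        by (intro norm_exp_diff_le) (simp_all add: Re_complex_birkhoff_sum birkhoff_le_ln_weight[OF W] cyl)
      also have "\<dots> \<le> weight ?w * (distortion * \<theta> ^ m)"
        using bounded_distortion[OF yE \<psi>(2)[OF y]] weight_pos[of ?w] by simp
      finally show "norm (exp (complex_birkhoff_sum n y) - exp (complex_birkhoff_sum n (\<psi> y))) \<le> weight ?w * (distortion * \<theta> ^ m)" .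
      show "norm (g (\<psi> y)) \<le> R"
        using norm_le_sample_point[OF g n yE(2)] \<psi>(3)[OF y] by (simp add: R_def)
      show "0 \<le> weight ?w * (distortion * \<theta> ^ m)" using weight_pos[of ?w] distortion_nonneg \<theta>_pos by simp
    qed (auto simp: less_imp_le[OF weight_pos])
    also have "\<dots> = ((1 + distortion) * \<theta> ^ m) * majorant n g ?w"
      by (simp add: majorant_def R_def algebra_simps)
    finally show "norm (?F y + - ?F (\<psi> y)) \<le> ((1 + distortion) * \<theta> ^ m) * majorant n g ?w" .
  qed
  also have "\<dots> = (1 + distortion) * infsum (majorant n g) (words I A n) * \<theta> ^ m"
    unfolding infsum_cmult_right' by (simp only: mult_ac)
  finally show ?thesis .
qed

lemma iter_op_outside: "x \<notin> E \<Longrightarrow> iter_op n g x = 0"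
proof -
  assume "x \<notin> E"
  then have "preimages n x = {}" using left_shift_pow_mem by (auto simp: preimages_def)
  then show ?thesis by (simp add: iter_op_def)
qed

lemma iter_op_norm:
  assumes g: "g \<in> X" and n: "1 \<le> n"
  shows "iter_op n g \<in> X" "N (iter_op n g) \<le> (2 + distortion) * infsum (majorant n g) (words I A n)"
proof -
  let ?M = "infsum (majorant n g) (words I A n)"
  have M: "0 \<le> ?M" by (intro infsum_nonneg majorant_nonneg)
  have C: "0 \<le> (1 + distortion) * ?M" using M distortion_nonneg by simp
  show "iter_op n g \<in> X"
    by (rule X_memI[where C = "(1 + distortion) * ?M" and S = ?M], rule iter_op_outside, assumption,
        rule iter_op_le_majorant[OF g n], rule C, rule iter_op_variation[OF g n])
  have "N (iter_op n g) \<le> (1 + distortion) * ?M + ?M"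
    by (rule X_memI[where C = "(1 + distortion) * ?M" and S = ?M], rule iter_op_outside, assumption,
        rule iter_op_le_majorant[OF g n], rule C, rule iter_op_variation[OF g n])
  then show "N (iter_op n g) \<le> (2 + distortion) * ?M" by (simp add: algebra_simps)
qed

lemma transfer_op_eq: "T g = iter_op 1 g"
  by (auto simp: fun_eq_iff transfer_op_def iter_op_def preimages_def complex_birkhoff_sum_def)

text \<open>
  A preimage under \<open>n + 1\<close> shifts is a preimage under one shift of a preimage under \<open>n\<close> shifts; absolute
  convergence allows the sum to be grouped accordingly.
\<close>

lemma iter_op_Suc:
  assumes g: "g \<in> X"
  shows "iter_op (Suc n) g = iter_op n (iter_op 1 g)"
proof
  fix x
  let ?S = "Sigma (preimages n x) (preimages 1)"
  let ?F = "\<lambda>y. exp (complex_birkhoff_sum (Suc n) y) * g y"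
  have bij: "bij_betw snd ?S (preimages (Suc n) x)"
    by (rule bij_betwI[where g = "\<lambda>y. (left_shift y, y)"])
      (use left_shift_pow_mem[of _ I A 1] in \<open>auto simp: preimages_def funpow_Suc_right simp del: funpow.simps\<close>)
  have s: "(\<lambda>p. ?F (snd p)) summable_on ?S"
    using summable_on_reindex_bij_betw[OF bij, of ?F] iter_op_summable[OF g] by blast
  have "iter_op (Suc n) g x = (\<Sum>\<^sub>\<infinity>p\<in>?S. ?F (snd p))"
    unfolding iter_op_def by (rule infsum_reindex_bij_betw[OF bij, symmetric])
  also have "\<dots> = (\<Sum>\<^sub>\<infinity>z\<in>preimages n x. \<Sum>\<^sub>\<infinity>y\<in>preimages 1 z. ?F y)"
    using infsum_Sigma_banach[OF s] by simp
  also have "\<dots> = (\<Sum>\<^sub>\<infinity>z\<in>preimages n x. exp (complex_birkhoff_sum n z) * (\<Sum>\<^sub>\<infinity>y\<in>preimages 1 z. exp (complex_birkhoff_sum 1 y) * g y))"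
  proof (rule infsum_cong)
    fix z assume "z \<in> preimages n x"
    have "(\<Sum>\<^sub>\<infinity>y\<in>preimages 1 z. ?F y) = (\<Sum>\<^sub>\<infinity>y\<in>preimages 1 z. exp (complex_birkhoff_sum n z) * (exp (complex_birkhoff_sum 1 y) * g y))"
    proof (rule infsum_cong)
      fix y assume "y \<in> preimages 1 z"
      then have "complex_birkhoff_sum (Suc n) y = complex_birkhoff_sum 1 y + complex_birkhoff_sum n z" using complex_birkhoff_sum_add[of 1 n y] by (simp add: preimages_def)
      then show "?F y = exp (complex_birkhoff_sum n z) * (exp (complex_birkhoff_sum 1 y) * g y)" by (simp add: exp_add)
    qed
    then show "(\<Sum>\<^sub>\<infinity>y\<in>preimages 1 z. ?F y) = exp (complex_birkhoff_sum n z) * (\<Sum>\<^sub>\<infinity>y\<in>preimages 1 z. exp (complex_birkhoff_sum 1 y) * g y)"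
      by (simp only: infsum_cmult_right')
  qed
  finally show "iter_op (Suc n) g x = iter_op n (iter_op 1 g) x" by (simp only: iter_op_def)
qed

lemma transfer_op_pow: "g \<in> X \<Longrightarrow> (T ^^ n) g = iter_op n g"
proof (induction n arbitrary: g)
  case 0
  have "iter_op 0 g x = g x" for x
  proof (cases "x \<in> E")
    case True
    then have "preimages 0 x = {x}" by (auto simp: preimages_def)
    then show ?thesis by (simp add: iter_op_def complex_birkhoff_sum_def)
  qed (simp add: iter_op_outside X_outside[OF 0])
  then show ?case by (simp add: fun_eq_iff)
next
  case (Suc n)
  have "(T ^^ Suc n) g = (T ^^ n) (T g)" by (simp add: funpow_swap1)
  also have "T g \<in> X" unfolding transfer_op_eq by (rule iter_op_norm(1)[OF Suc.prems]) simp
  then have "(T ^^ n) (T g) = iter_op n (T g)" by (rule Suc.IH)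
  finally show ?case unfolding transfer_op_eq iter_op_Suc[OF Suc.prems] .
qed

lemma infsum_majorant_le: "g \<in> X \<Longrightarrow> infsum (majorant n g) (words I A n) \<le> partition_sum n * N g"
proof -
  assume g: "g \<in> X"
  have "infsum (majorant n g) (words I A n) \<le> (\<Sum>\<^sub>\<infinity>w\<in>words I A n. weight w * N g)"
    by (intro infsum_mono majorant_summable g majorant_le summable_on_cmult_left summable_weight)
  then show ?thesis by (simp add: infsum_cmult_left' partition_sum_def)
qed

sublocale bounded_operator X N T
proof
  have "T (\<lambda>x. g x + h x) = (\<lambda>x. T g x + T h x)" if "g \<in> X" "h \<in> X" for g h
    using infsum_add[OF iter_op_summable[OF that(1)] iter_op_summable[OF that(2)]]
    unfolding transfer_op_eq iter_op_def by (simp add: fun_eq_iff algebra_simps)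
  moreover have "T (\<lambda>x. c * g x) = (\<lambda>x. c * T g x)" for c g
    unfolding transfer_op_eq iter_op_def by (simp add: infsum_cmult_right'[symmetric] mult.left_commute)
  moreover have "N (T g) \<le> ((2 + distortion) * partition_sum 1) * N g" if "g \<in> X" for g
  proof -
    have "N (T g) \<le> (2 + distortion) * infsum (majorant 1 g) (words I A 1)"
      unfolding transfer_op_eq by (rule iter_op_norm(2)[OF that]) simp
    also have "\<dots> \<le> (2 + distortion) * (partition_sum 1 * N g)"
      using distortion_nonneg by (intro mult_left_mono infsum_majorant_le that) auto
    finally show ?thesis by (simp add: mult.assoc)
  qed
  moreover have "T g \<in> X" if "g \<in> X" for g
    unfolding transfer_op_eq by (rule iter_op_norm(1)[OF that]) simp
  ultimately show "bounded_operator_on X N T"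
    unfolding bounded_operator_on_def by blast
qed

end

section \<open>The pressure as growth rate of the partition function\<close>

lemma words_admissible:
  assumes "w \<in> words I A n"
  shows "\<And>k. k < n \<Longrightarrow> w ! k \<in> I" "\<And>k. Suc k < n \<Longrightarrow> A (w ! k) (w ! Suc k)"
  using assms by (auto simp: words_def shift_space_def)

text \<open>
  Irreducibility connects some letter to itself; repeating the resulting loop for ever gives the point.
\<close>

lemma periodic_point_exists:
  assumes irr: "finitely_irreducible I A" and "I \<noteq> {}"
  obtains y L where "y \<in> shift_space I A" "0 < L" "\<And>j. (left_shift ^^ j) y = (left_shift ^^ (j mod L)) y"
proof -
  from \<open>I \<noteq> {}\<close> obtain i where i: "i \<in> I" by blast
  from irr i obtain \<omega> n where w: "[i] @ \<omega> @ [i] \<in> words I A n"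
    unfolding finitely_irreducible_def all_words_def by blast
  define v where "v = [i] @ \<omega> @ [i]"
  define L where "L = length \<omega> + 1"
  have n: "n = Suc L" using words_length[OF w] by (simp add: L_def)
  have v: "\<And>k. k < Suc L \<Longrightarrow> v ! k \<in> I" "\<And>k. k < L \<Longrightarrow> A (v ! k) (v ! Suc k)"
    using words_admissible[OF w] unfolding v_def n by auto
  have L: "0 < L" by (simp add: L_def)
  \<comment> \<open>The word \<open>v\<close> contains one letter more than the loop, so that the return step is admissible.\<close>
  have wrap: "v ! L = v ! 0" by (simp add: v_def L_def nth_append)
  define y where "y = (\<lambda>k. v ! (k mod L))"
  have "A (y k) (y (Suc k))" for k
  proof -
    have "y (Suc k) = v ! Suc (k mod L)" using wrap L by (simp add: y_def mod_Suc)
    then show ?thesis using v(2)[of "k mod L"] L by (simp add: y_def)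
  qed
  then have "y \<in> shift_space I A" using v(1) L by (auto simp: shift_space_def y_def less_SucI)
  moreover have "(left_shift ^^ j) y = (left_shift ^^ (j mod L)) y" for j
    by (simp add: fun_eq_iff left_shift_pow y_def mod_add_left_eq)
  ultimately show thesis using that L by blast
qed

context holder_potential
begin

lemma birkhoff_le_ln_partition_sum:
  assumes y: "y \<in> E" shows "birkhoff_sum n u y \<le> ln (partition_sum n)"
proof -
  note w = prefix_mem_words[OF y, of n]
  have "birkhoff_sum n u y \<le> ln (weight (map y [0..<n]))"
    by (rule birkhoff_le_ln_weight[OF w mem_cylinder_prefix[OF y]])
  also have "\<dots> \<le> ln (partition_sum n)" using weight_le_partition_sum[OF w] weight_pos partition_sum_pos by simp
  finally show ?thesis .
qed

text \<open>
  Submultiplicativity of the partition function gives convergence once the logarithms are bounded below by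
  a linear function. Such a bound comes from a periodic orbit, on which \<open>u\<close> takes finitely many values.
\<close>

lemma pressure_limit:
  assumes irr: "finitely_irreducible I A"
  shows "(\<lambda>n. ln (partition_sum n) / real n) \<longlonglongrightarrow> pressure I A u"
proof -
  have "I \<noteq> {}" using nonempty by (auto simp: shift_space_def)
  then obtain y L where y: "y \<in> E" and L: "0 < L"
    and per: "\<And>j. (left_shift ^^ j) y = (left_shift ^^ (j mod L)) y"
    using periodic_point_exists[OF irr] by blast
  define c where "c = Min ((\<lambda>j. u ((left_shift ^^ j) y)) ` {..<L})"
  have c: "c \<le> u ((left_shift ^^ j) y)" for j
    unfolding per[of j] c_def using L by (intro Min_le) auto
  have "c * real n \<le> ln (partition_sum n)" for n
  proof -
    have "(\<Sum>j<n. c) \<le> birkhoff_sum n u y" unfolding birkhoff_sum_def by (intro sum_mono c)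
    then show ?thesis using birkhoff_le_ln_partition_sum[OF y, of n] by (simp add: mult.commute)
  qed
  moreover have "ln (partition_sum (m + n)) \<le> ln (partition_sum m) + ln (partition_sum n)" for m n
  proof -
    have "ln (partition_sum (m + n)) \<le> ln (partition_sum m * partition_sum n)" using partition_sum_add_le[of m n] partition_sum_pos by simp
    then show ?thesis using partition_sum_pos[of m] partition_sum_pos[of n] by (simp add: ln_mult)
  qed
  ultimately have conv: "convergent (\<lambda>n. ln (partition_sum n) / real n)"
    by (intro subadditive_quotient_convergent[of _ c])
  have "(\<Sum>\<^sub>\<infinity>\<omega>\<in>words I A n. exp (SUP \<tau>\<in>cylinder I A \<omega>. birkhoff_sum n u \<tau>)) = partition_sum n" for n
    unfolding partition_sum_def weight_def by (rule infsum_cong) (simp add: words_length)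
  then have "pressure I A u = lim (\<lambda>n. ln (partition_sum n) / real n)"
    unfolding pressure_def by simp
  then show ?thesis using conv by (simp add: convergent_LIMSEQ_iff)
qed

section \<open>The spectrum of the transfer operator\<close>

lemma sample_point_inj: "inj_on sample_point (words I A n)"
proof (rule inj_onI)
  fix v w assume v: "v \<in> words I A n" and w: "w \<in> words I A n" and eq: "sample_point v = sample_point w"
  have "\<forall>i<n. v ! i = w ! i"
    using sample_point_mem[OF v] sample_point_mem[OF w] eq words_length[OF v] words_length[OF w] by (auto simp: cylinder_def)
  then show "v = w" using words_length[OF v] words_length[OF w] by (simp add: nth_equalityI)
qed

text \<open>
  One factor \<open>sqrt \<theta> ^ n\<close> of \<open>\<theta> ^ n\<close> absorbs the subexponential excess of \<open>partition_sum n\<close> over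
  \<open>exp P ^ n\<close>, the other one makes the product small.
\<close>

lemma eventual_contraction:
  assumes irr: "finitely_irreducible I A"
  obtains n where "1 \<le> n" "(2 + distortion) * (partition_sum n * \<theta> ^ n) \<le> exp (pressure I A u) ^ n / 4"
proof -
  let ?P = "pressure I A u"
  define s where "s = sqrt \<theta>"
  have s: "0 < s" "s < 1" "s * s = \<theta>" using \<theta>_pos \<theta>_less by (auto simp: s_def)
  have "\<forall>\<^sub>F n in sequentially. ln (partition_sum n) / real n < ?P - ln s"
    using s by (intro order_tendstoD(2)[OF pressure_limit[OF irr]]) simp
  moreover have "(\<lambda>n. (2 + distortion) * s ^ n) \<longlonglongrightarrow> (2 + distortion) * 0"
    using s by (intro tendsto_mult_left LIMSEQ_realpow_zero) auto
  then have "\<forall>\<^sub>F n in sequentially. (2 + distortion) * s ^ n < 1 / 4"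
    by (rule order_tendstoD(2)) simp
  moreover have "\<forall>\<^sub>F n in sequentially. (1::nat) \<le> n" by (rule eventually_ge_at_top)
  ultimately have "\<forall>\<^sub>F n in sequentially. ln (partition_sum n) / real n < ?P - ln s \<and> (2 + distortion) * s ^ n < 1 / 4 \<and> 1 \<le> n"
    by eventually_elim simp
  then obtain n where n: "ln (partition_sum n) / real n < ?P - ln s" "(2 + distortion) * s ^ n < 1 / 4" "1 \<le> n"
    by (auto simp: eventually_sequentially)
  have "ln (partition_sum n) \<le> real n * ?P - real n * ln s" using n(1,3) by (simp add: field_simps)
  then have "exp (ln (partition_sum n)) \<le> exp (real n * ?P - real n * ln s)" by simp
  then have "partition_sum n \<le> exp ?P ^ n / s ^ n"
    using s partition_sum_pos[of n] by (simp add: exp_diff exp_of_nat_mult)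
  then have "partition_sum n * s ^ n \<le> exp ?P ^ n" using s by (simp add: field_simps)
  moreover have "\<theta> ^ n = s ^ n * s ^ n" using s(3) by (simp add: power_mult_distrib[symmetric])
  ultimately have "(2 + distortion) * (partition_sum n * \<theta> ^ n) \<le> ((2 + distortion) * s ^ n) * exp ?P ^ n"
    using distortion_nonneg s mult_left_mono[of "partition_sum n * s ^ n" "exp ?P ^ n" "(2 + distortion) * s ^ n"] by (simp add: mult_ac)
  also have "\<dots> \<le> (1 / 4) * exp ?P ^ n" using n(2) by (intro mult_right_mono) auto
  finally show thesis using that n(3) by simp
qed

text \<open>
  The finitely many words in \<open>F\<close> are chosen to carry all but \<open>\<epsilon>\<close> of the partition function. On the
  remaining words the values at the sample points are bounded by the norm.
\<close>

lemma lasota_yorke: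
  assumes n: "1 \<le> n" and \<epsilon>: "0 < \<epsilon>"
  obtains F where "finite F"
    "\<And>g. g \<in> X \<Longrightarrow> N ((T ^^ n) g)
       \<le> (2 + distortion) * (partition_sum n * \<theta> ^ n + \<epsilon>) * N g + (2 + distortion) * partition_sum n * (\<Sum>d\<in>F. norm (g d))"
proof -
  obtain F where F: "finite F" "F \<subseteq> words I A n" "dist (sum weight F) (partition_sum n) \<le> \<epsilon>"
    using infsum_finite_approximation[OF summable_weight \<epsilon>, of n] by (auto simp: partition_sum_def)
  have sF: "weight summable_on (words I A n - F)"
    by (rule summable_on_subset_banach[OF summable_weight[of n]]) auto
  have "infsum weight (F \<union> (words I A n - F)) = infsum weight F + infsum weight (words I A n - F)"
    using F(1) sF by (intro infsum_Un_disjoint) auto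
  then have "partition_sum n = sum weight F + infsum weight (words I A n - F)"
    using F by (simp add: partition_sum_def Un_absorb1)
  then have tail: "infsum weight (words I A n - F) \<le> \<epsilon>"
    using F(3) by (simp add: dist_real_def)
  have "N ((T ^^ n) g) \<le> (2 + distortion) * (partition_sum n * \<theta> ^ n + \<epsilon>) * N g + (2 + distortion) * partition_sum n * (\<Sum>d\<in>sample_point ` F. norm (g d))"
    if g: "g \<in> X" for g
  proof -
    let ?b = "\<lambda>w. weight w * norm (g (sample_point w))"
    have le: "?b w \<le> weight w * N g" for w
      using eval_le[OF g] weight_pos[of w] by (intro mult_left_mono) auto
    have b: "?b summable_on words I A n"
      by (rule summable_on_comparison_test[OF summable_on_cmult_left[OF summable_weight, of "N g"]])
        (auto simp: le less_imp_le[OF weight_pos])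
    have b': "?b summable_on (words I A n - F)"
      by (rule summable_on_subset_banach[OF b]) auto
    have h: "(\<lambda>w. weight w * (\<theta> ^ n * holder_coeff g)) summable_on words I A n"
      by (intro summable_on_cmult_left summable_weight)
    have "infsum (majorant n g) (words I A n) = infsum ?b (words I A n) + partition_sum n * (\<theta> ^ n * holder_coeff g)"
      using infsum_add[OF b h] unfolding majorant_def distrib_left infsum_cmult_left' partition_sum_def .
    also have "infsum ?b (words I A n) = sum ?b F + infsum ?b (words I A n - F)"
      using infsum_Un_disjoint[of ?b F "words I A n - F"] F b' by (simp add: Un_absorb1)
    also have "infsum ?b (words I A n - F) \<le> (\<Sum>\<^sub>\<infinity>w\<in>words I A n - F. weight w * N g)"
      by (intro infsum_mono b' summable_on_cmult_left sF le)
    also have "\<dots> \<le> \<epsilon> * N g"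
      unfolding infsum_cmult_left' by (intro mult_right_mono tail norm_nonneg g)
    also have "sum ?b F \<le> (\<Sum>w\<in>F. partition_sum n * norm (g (sample_point w)))"
      using F(2) by (intro sum_mono mult_right_mono weight_le_partition_sum) auto
    also have "\<dots> = partition_sum n * (\<Sum>d\<in>sample_point ` F. norm (g d))"
      by (simp add: sum.reindex[OF inj_on_subset[OF sample_point_inj F(2)]] sum_distrib_left)
    also have "partition_sum n * (\<theta> ^ n * holder_coeff g) \<le> partition_sum n * (\<theta> ^ n * N g)"
      using partition_sum_pos[of n] \<theta>_pos sup_norm_nonneg[OF g] by (intro mult_left_mono) (auto simp: N_eq)
    finally have "infsum (majorant n g) (words I A n)
        \<le> partition_sum n * (\<Sum>d\<in>sample_point ` F. norm (g d)) + \<epsilon> * N g + partition_sum n * (\<theta> ^ n * N g)" by simp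
    then have "(2 + distortion) * infsum (majorant n g) (words I A n)
        \<le> (2 + distortion) * (partition_sum n * (\<Sum>d\<in>sample_point ` F. norm (g d)) + \<epsilon> * N g + partition_sum n * (\<theta> ^ n * N g))"
      using distortion_nonneg by (intro mult_left_mono) auto
    then show ?thesis
      using iter_op_norm(2)[OF g n] by (simp add: transfer_op_pow[OF g] algebra_simps)
  qed
  then show thesis using that[of "sample_point ` F"] F(1) by blast
qed

text \<open>
  If \<open>T g = w g\<close>, then \<open>\<bar>w\<bar> ^ n \<bar>g x\<bar> \<le> partition_sum n * sup \<bar>g\<bar>\<close> for all \<open>n\<close>; take logarithms at a
  point where \<open>g\<close> does not vanish and divide by \<open>n\<close>.
\<close>

lemma eigenvalue_le:
  assumes irr: "finitely_irreducible I A" and g: "g \<in> X" "g \<noteq> (\<lambda>x. 0)" and eig: "T g = (\<lambda>x. w * g x)"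
  shows "norm w \<le> exp (pressure I A u)"
proof (cases "w = 0")
  case False
  obtain x where x: "g x \<noteq> 0" using g(2) by blast
  have pow: "(T ^^ n) g = (\<lambda>x. w ^ n * g x)" for n
  proof (induction n)
    case (Suc n)
    then show ?case using op_scale[OF g(1), of "w ^ n"] by (simp add: eig mult_ac)
  qed simp
  have pos: "0 < sup_norm g" using norm_le_sup_norm[OF g(1), of x] x by (meson less_le_trans zero_less_norm_iff)
  define c where "c = ln (sup_norm g) - ln (norm (g x))"
  have "ln (norm w) - c / real n \<le> ln (partition_sum n) / real n" if n: "1 \<le> n" for n
  proof -
    have "norm w ^ n * norm (g x) \<le> partition_sum n * sup_norm g"
      using iter_op_sum(2)[OF g(1), of n x] transfer_op_pow[OF g(1), of n]
      by (simp add: pow norm_mult norm_power fun_eq_iff flip: transfer_op_pow[OF g(1)])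
    then have "ln (norm w ^ n * norm (g x)) \<le> ln (partition_sum n * sup_norm g)"
      using False x pos partition_sum_pos[of n] by simp
    then have "real n * ln (norm w) - c \<le> ln (partition_sum n)"
      using False x pos partition_sum_pos[of n] by (simp add: ln_mult ln_realpow c_def)
    then have "ln (norm w) \<le> (c + ln (partition_sum n)) / real n" using n by (simp add: pos_le_divide_eq mult.commute)
    then show ?thesis by (simp add: add_divide_distrib)
  qed
  moreover have "(\<lambda>n. ln (norm w) - c / real n) \<longlonglongrightarrow> ln (norm w) - 0"
    by (intro tendsto_diff tendsto_const lim_const_over_n)
  ultimately have "ln (norm w) - 0 \<le> pressure I A u"
    using LIMSEQ_le[OF _ pressure_limit[OF irr]] by blast
  then have "exp (ln (norm w)) \<le> exp (pressure I A u)" by simp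
  then show ?thesis using False by simp
qed simp

text \<open>
  By the previous lemma such an eigenvalue lies on the circle of radius \<open>exp P\<close>. Its argument in
  \<open>[0, 2\<pi>)\<close> makes \<open>f\<close> an \<open>a\<close>-function, since Hoelder eigenvectors are bounded and continuous.
\<close>

lemma no_eigenvalue_outside:
  assumes irr: "finitely_irreducible I A" and reg: "regular_potential I A f"
    and w: "exp (pressure I A u) \<le> norm w"
  shows "\<not> eigenvalue_on X T w"
proof
  assume "eigenvalue_on X T w"
  then obtain g where g: "g \<in> X" "g \<noteq> (\<lambda>x. 0)" "T g = (\<lambda>x. w * g x)"
    by (auto simp: eigenvalue_on_def)
  have nw: "norm w = exp (pressure I A u)" using eigenvalue_le[OF irr g] w by linarith
  have "w = norm w * exp (\<i> * complex_of_real (Arg2pi w))" by (rule Arg2pi_eq)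
  then have "exp (\<i> * complex_of_real (Arg2pi w) + complex_of_real (pressure I A u)) = w"
    unfolding nw by (simp add: exp_add exp_of_real mult.commute)
  moreover have "eigenvalue_on (bounded_cont_space I A) T w"
    unfolding eigenvalue_on_def using g by (auto simp: bounded_holder_space_def)
  ultimately have "a_function I A (Arg2pi w) f" by (simp add: a_function_def)
  moreover have "0 \<le> Arg2pi w" "Arg2pi w < 2 * pi" by (simp_all add: Arg2pi_ge_0 Arg2pi_lt_2pi)
  ultimately show False using reg by (auto simp: regular_potential_def)
qed

theorem regular_imp_spectral_gap:
  assumes irr: "finitely_irreducible I A" and reg: "regular_potential I A f"
  shows "\<exists>r. 0 \<le> r \<and> r < exp (pressure I A u) \<and> spectrum_on X N T \<subseteq> cball 0 r"
proof -
  let ?\<rho> = "exp (pressure I A u)"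
  obtain n where n: "1 \<le> n" "(2 + distortion) * (partition_sum n * \<theta> ^ n) \<le> ?\<rho> ^ n / 4" using eventual_contraction[OF irr] .
  define \<epsilon> where "\<epsilon> = ?\<rho> ^ n / 4 / (2 + distortion)"
  have nz: "2 + distortion \<noteq> 0" using distortion_nonneg by linarith
  have \<epsilon>: "0 < \<epsilon>" using distortion_nonneg by (simp add: \<epsilon>_def add_pos_nonneg)
  obtain F where F: "finite F" "\<And>g. g \<in> X \<Longrightarrow> N ((T ^^ n) g)
       \<le> (2 + distortion) * (partition_sum n * \<theta> ^ n + \<epsilon>) * N g + (2 + distortion) * partition_sum n * (\<Sum>d\<in>F. norm (g d))"
    using lasota_yorke[OF n(1) \<epsilon>] by blast
  have "(2 + distortion) * \<epsilon> = ?\<rho> ^ n / 4"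
    using nonzero_mult_div_cancel_left[OF nz, of "?\<rho> ^ n / 4"]
    by (simp only: \<epsilon>_def times_divide_eq_right)
  then have le: "(2 + distortion) * (partition_sum n * \<theta> ^ n + \<epsilon>) \<le> 1 / 2 * ?\<rho> ^ n" using n(2) by (simp add: distrib_left)
  show ?thesis
  proof (rule spectrum_in_smaller_disc[OF _ F(1)])
    show "N ((T ^^ n) g) \<le> 1 / 2 * ?\<rho> ^ n * N g + (2 + distortion) * partition_sum n * (\<Sum>d\<in>F. norm (g d))" if g: "g \<in> X" for g
      using F(2)[OF g] mult_right_mono[OF le norm_nonneg[OF g]] by linarith
    show "\<not> eigenvalue_on X T w" if "?\<rho> \<le> norm w" for w
      by (rule no_eigenvalue_outside[OF irr reg that])
    show "0 \<le> (2 + distortion) * partition_sum n" using distortion_nonneg partition_sum_pos[of n] by simp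
  qed auto
qed

end

text \<open>
  The function space is trivial, so the identity inverts every \<open>z - T\<close>. The norm is left arbitrary
  because the supremum over the empty set has an unspecified value.
\<close>

lemma spectrum_empty_shift:
  assumes E: "shift_space I A = {}"
  shows "spectrum_on (bounded_holder_space I A \<theta>) M (transfer_op I A f) = {}"
proof -
  have zero: "g = (\<lambda>x. 0)" if "g \<in> bounded_holder_space I A \<theta>" for g
    using that by (auto simp: bounded_holder_space_def bounded_cont_space_def E)
  have T: "transfer_op I A f g = (\<lambda>x. 0)" for g
    by (auto simp: transfer_op_outside E)
  have "bounded_operator_on (bounded_holder_space I A \<theta>) M (\<lambda>g. g)"
    unfolding bounded_operator_on_def by (auto intro: exI[of _ 1])
  moreover have "(\<lambda>x. z * g x - transfer_op I A f g x) = g" if "g \<in> bounded_holder_space I A \<theta>" for z g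
    using zero[OF that] by (simp add: T)
  ultimately show ?thesis unfolding spectrum_on_def by blast
qed

theorem theorem2p14:
  fixes I :: "nat set" and A :: "nat \<Rightarrow> nat \<Rightarrow> bool" and \<theta> :: real
    and u v :: "(nat \<Rightarrow> nat) \<Rightarrow> real" and f :: "(nat \<Rightarrow> nat) \<Rightarrow> complex"
  assumes "finitely_irreducible I A"
    and "0 < \<theta>" and "\<theta> < 1"
    and "f = (\<lambda>x. complex_of_real (u x) + \<i> * complex_of_real (v x))"
    and "f \<in> holder_space I A \<theta>"
    and "summable_potential I A u"
    and "regular_potential I A f"
  shows "\<exists>r. 0 \<le> r \<and> r < exp (pressure I A u) \<and>
           spectrum_on (bounded_holder_space I A \<theta>) (bounded_holder_norm I A \<theta>)
             (transfer_op I A f) \<subseteq> cball 0 r"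
proof (cases "shift_space I A = {}")
  case True
  then show ?thesis by (auto simp: spectrum_empty_shift intro!: exI[of _ 0])
next
  case False
  have u: "(\<lambda>x. Re (f x)) = u" using assms(4) by simp
  interpret holder_potential I A \<theta> f
    using assms False by unfold_locales (simp_all add: u)
  show ?thesis using regular_imp_spectral_gap[OF assms(1,7)] unfolding u .
qed

end
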